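(* The group $H^{1}(M(\mathbb{T}))$ is uncountable.
   Context: $\mathbb{T}$ is the circle group (identified with $\mathbb{R}/2\pi\mathbb{Z}$). $M(\mathbb{T})$ is the commutative unital Banach algebra of complex regular Borel measures on $\mathbb{T}$, with convolution as multiplication, the total variation norm, and unit $\delta_0$. For a complex commutative Banach algebra $A$ with unit, $G(A)$ denotes the group of invertible elements of $A$, $\mathrm{Exp}(A)=\{\exp(a): a\in A\}$ is the subgroup of exponentials (where $\exp(a)=\sum_{k\ge 0} a^k/k!$), and $H^{1}(A):=G(A)/\mathrm{Exp}(A)$ is the quotient group. *)

theory Defs
  imports "HOL-Analysis.Analysis" "HOL-Algebra.Coset" "HOL-Algebra.Module"
begin

record 'a normed_algebra = "(complex, 'a) module" +
  alg_norm :: "'a \<Rightarrow> real"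

definition has_exp :: "('a, 'm) normed_algebra_scheme \<Rightarrow> 'a \<Rightarrow> 'a \<Rightarrow> bool" where
  "has_exp A a b \<longleftrightarrow>
     (\<lambda>n. alg_norm A (b \<ominus>\<^bsub>A\<^esub> (\<Oplus>\<^bsub>A\<^esub>k\<in>{..<n}. (1 / fact k) \<odot>\<^bsub>A\<^esub> (a [^]\<^bsub>A\<^esub> (k::nat)))))
       \<longlonglongrightarrow> 0"

definition Exp :: "('a, 'm) normed_algebra_scheme \<Rightarrow> 'a set" where
  "Exp A = {b \<in> carrier A. \<exists>a\<in>carrier A. has_exp A a b}"

definition H1 :: "('a, 'm) normed_algebra_scheme \<Rightarrow> 'a set monoid" where
  "H1 A = units_of A Mod Exp A"

text \<open>
  A complex measure on a measurable space is a countably additive complex set function. The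
  type \<^typ>\<open>'a measure\<close> only covers nonnegative measures; below, an argument \<open>M\<close> of this type
  merely provides the measurable space, and its own measure is never used. To make equality of
  complex measures coincide with equality of functions, the value outside the sigma-algebra is
  fixed to be \<open>0\<close>. Countable additivity, applied to the constant family of empty sets, forces
  the value \<open>0\<close> on the empty set.
\<close>

definition complex_measure :: "'a measure \<Rightarrow> ('a set \<Rightarrow> complex) \<Rightarrow> bool" where
  "complex_measure M \<mu> \<longleftrightarrow>
     (\<forall>E. range E \<subseteq> sets M \<longrightarrow> disjoint_family E \<longrightarrow>
        (\<lambda>i::nat. \<mu> (E i)) sums \<mu> (\<Union>i. E i)) \<and>
     (\<forall>E. E \<notin> sets M \<longrightarrow> \<mu> E = 0)"

definition total_variation ::
    "'a measure \<Rightarrow> ('a set \<Rightarrow> 'b::real_normed_vector) \<Rightarrow> 'a set \<Rightarrow> ennreal" where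
  "total_variation M \<mu> E =
     (SUP P\<in>{P. range P \<subseteq> sets M \<and> disjoint_family P \<and> (\<Union>i. P i) = E}.
        \<Sum>i::nat. ennreal (norm (\<mu> (P i))))"

text \<open>
  The positive part \<open>(\<bar>\<nu>\<bar> + \<nu>) / 2\<close> in the Jordan decomposition of a real measure \<open>\<nu>\<close>. The
  negative part is the positive part of \<open>-\<nu>\<close>.
\<close>

definition pos_part_measure :: "'a measure \<Rightarrow> ('a set \<Rightarrow> real) \<Rightarrow> 'a measure" where
  "pos_part_measure M \<nu> =
     measure_of (space M) (sets M)
       (\<lambda>E. ennreal ((enn2real (total_variation M \<nu> E) + \<nu> E) / 2))"

definition real_measure_integral ::
    "'a measure \<Rightarrow> ('a set \<Rightarrow> real) \<Rightarrow> ('a \<Rightarrow> complex) \<Rightarrow> complex" where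
  "real_measure_integral M \<nu> f =
     integral\<^sup>L (pos_part_measure M \<nu>) f - integral\<^sup>L (pos_part_measure M (\<lambda>E. - \<nu> E)) f"

definition complex_measure_integral ::
    "'a measure \<Rightarrow> ('a set \<Rightarrow> complex) \<Rightarrow> ('a \<Rightarrow> complex) \<Rightarrow> complex" where
  "complex_measure_integral M \<mu> f =
     real_measure_integral M (\<lambda>E. Re (\<mu> E)) f + \<i> * real_measure_integral M (\<lambda>E. Im (\<mu> E)) f"

text \<open>
  The circle group is realised as the multiplicative group of complex numbers of modulus \<open>1\<close>.
\<close>

abbreviation circle :: "complex set" where
  "circle \<equiv> sphere 0 1"

abbreviation circle_borel :: "complex measure" where
  "circle_borel \<equiv> restrict_space borel circle"

definition regular_on_circle :: "(complex set \<Rightarrow> complex) \<Rightarrow> bool" where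
  "regular_on_circle \<mu> \<longleftrightarrow>
     (\<forall>E\<in>sets circle_borel.
        total_variation circle_borel \<mu> E =
          (INF U\<in>{U. openin (top_of_set circle) U \<and> E \<subseteq> U}. total_variation circle_borel \<mu> U) \<and>
        total_variation circle_borel \<mu> E =
          (SUP K\<in>{K. compact K \<and> K \<subseteq> E}. total_variation circle_borel \<mu> K))"

text \<open>The set \<open>{x \<in> circle. x * y \<in> E}\<close> is the translate of \<open>E\<close> by the inverse of \<open>y\<close>.\<close>

definition convolution ::
    "(complex set \<Rightarrow> complex) \<Rightarrow> (complex set \<Rightarrow> complex) \<Rightarrow> complex set \<Rightarrow> complex" where
  "convolution \<mu> \<nu> E =
     (if E \<in> sets circle_borel
      then complex_measure_integral circle_borel \<nu> (\<lambda>y. \<mu> {x \<in> circle. x * y \<in> E})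
      else 0)"

definition dirac :: "complex \<Rightarrow> complex set \<Rightarrow> complex" where
  "dirac z E = (if E \<in> sets circle_borel \<and> z \<in> E then 1 else 0)"

text \<open>
  The neutral element of the circle is the complex number \<open>1\<close>, so \<^term>\<open>dirac 1\<close> is the unit
  measure usually denoted \<open>\<delta>\<^sub>0\<close> when the group is written additively.
\<close>

definition circle_measure_algebra :: "(complex set \<Rightarrow> complex) normed_algebra" where
  "circle_measure_algebra =
     \<lparr>carrier = {\<mu>. complex_measure circle_borel \<mu> \<and> regular_on_circle \<mu>},
      monoid.mult = convolution,
      one = dirac 1,
      zero = (\<lambda>E. 0),
      add = (\<lambda>\<mu> \<nu> E. \<mu> E + \<nu> E),
      smult = (\<lambda>c \<mu> E. c * \<mu> E),
      alg_norm = (\<lambda>\<mu>. enn2real (total_variation circle_borel \<mu> circle))\<rparr>"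

end

theory Submission
  imports Defs "HOL-Probability.Giry_Monad"
begin

text \<open>
  The point masses already give uncountably many classes. For a natural number \<open>n\<close> let \<open>\<Phi>\<^sub>n \<mu>\<close>
  be the \<open>n\<close>-th Fourier coefficient \<open>\<Sum>x. \<mu> {x} x\<^sup>n\<close> of the discrete part of \<open>\<mu>\<close>; this is a
  contractive multiplicative functional. If \<open>dirac z = exp a\<close> and \<open>f n = \<Phi>\<^sub>n a\<close>, then \<open>exp (f n) = z\<^sup>n\<close>.
  The sequence \<open>f\<close> is almost periodic: by simultaneous Dirichlet approximation on finitely many atoms
  of \<open>a\<close> carrying almost all of its discrete mass, some \<open>p \<ge> 1\<close> satisfies \<open>\<bar>f (n + p) - f n\<bar> < 1\<close>
  for all \<open>n\<close>. Since \<open>exp (f (n + p) - f n) = z\<^sup>p\<close>, this difference does not depend on \<open>n\<close>, and since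
  \<open>f\<close> is bounded, it vanishes, so that \<open>z\<^sup>p = 1\<close>. Hence \<open>dirac z\<close> and \<open>dirac w\<close> lie in the same class
  only if \<open>z / w\<close> is a root of unity, and there are only countably many of these.
\<close>

subsection \<open>Total variation\<close>

text \<open>Countable additivity for values in any normed space, without the convention outside the
  sigma-algebra. Thus complex measures, their real and imaginary parts, and \<open>measure m\<close>
  for finite positive \<open>m\<close> all fall under the same lemmas.\<close>

definition vector_measure :: "'a measure \<Rightarrow> ('a set \<Rightarrow> 'b::real_normed_vector) \<Rightarrow> bool" where
  "vector_measure M \<nu> \<longleftrightarrow>
     (\<forall>E. range E \<subseteq> sets M \<longrightarrow> disjoint_family E \<longrightarrow>
        (\<lambda>i::nat. \<nu> (E i)) sums \<nu> (\<Union>i. E i))"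

lemma vector_measureD:
  "vector_measure M \<nu> \<Longrightarrow> range E \<subseteq> sets M \<Longrightarrow> disjoint_family E \<Longrightarrow>
     (\<lambda>i::nat. \<nu> (E i)) sums \<nu> (\<Union>i. E i)"
  by (simp add: vector_measure_def)

lemma vector_measure_empty:
  assumes "vector_measure M \<nu>"
  shows "\<nu> {} = 0"
proof -
  have "(\<lambda>i::nat. \<nu> {}) sums \<nu> (\<Union>i::nat. {})"
    by (rule vector_measureD[OF assms]) (auto simp: disjoint_family_on_def)
  then have "(\<lambda>i::nat. \<nu> {}) \<longlonglongrightarrow> 0"
    using sums_summable summable_LIMSEQ_zero by blast
  then show ?thesis by (simp add: LIMSEQ_const_iff)
qed

lemma vector_measure_Un:
  assumes "vector_measure M \<nu>" "A \<in> sets M" "B \<in> sets M" "A \<inter> B = {}"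
  shows "\<nu> (A \<union> B) = \<nu> A + \<nu> B"
proof -
  have "(\<lambda>n. \<nu> (binaryset A B n)) sums \<nu> (\<Union>n. binaryset A B n)"
    using assms
    by (intro vector_measureD[OF assms(1)])
      (auto simp: range_binaryset_eq disjoint_family_on_def binaryset_def)
  moreover have "(\<lambda>n. \<nu> (binaryset A B n)) sums (\<nu> A + \<nu> B)"
    by (rule binaryset_sums) (rule vector_measure_empty[OF assms(1)])
  ultimately show ?thesis
    by (simp add: UN_binaryset_eq sums_unique2)
qed

lemma vector_measure_Diff:
  assumes "vector_measure M \<nu>" "A \<in> sets M" "B \<in> sets M" "A \<subseteq> B"
  shows "\<nu> (B - A) = \<nu> B - \<nu> A"
  using vector_measure_Un[of M \<nu> A "B - A"] assms by (simp add: Un_absorb1)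

lemma vector_measure_UN_finite:
  assumes "vector_measure M \<nu>" "finite S" "disjoint_family_on P S" "\<And>i. i \<in> S \<Longrightarrow> P i \<in> sets M"
  shows "\<nu> (\<Union>i\<in>S. P i) = (\<Sum>i\<in>S. \<nu> (P i))"
  using assms(2-)
proof (induction S rule: finite_induct)
  case empty
  then show ?case by (simp add: vector_measure_empty[OF assms(1)])
next
  case (insert x F)
  have "disjoint_family_on P F"
    using insert.prems(1) by (auto simp: disjoint_family_on_def)
  moreover have "\<nu> (P x \<union> (\<Union>i\<in>F. P i)) = \<nu> (P x) + \<nu> (\<Union>i\<in>F. P i)"
    using insert.prems insert.hyps
    by (intro vector_measure_Un[OF assms(1)]) (auto simp: disjoint_family_on_def)
  ultimately show ?case using insert by simp
qed

section \<open>Countable additivity of the total variation\<close>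

lemma total_variation_upper:
  assumes "range P \<subseteq> sets M" "disjoint_family P" "(\<Union>i. P i) = E"
  shows "(\<Sum>i::nat. ennreal (norm (\<nu> (P i)))) \<le> total_variation M \<nu> E"
  unfolding total_variation_def using assms by (intro SUP_upper) auto

lemma total_variation_norm_le:
  assumes "vector_measure M \<nu>" "E \<in> sets M"
  shows "ennreal (norm (\<nu> E)) \<le> total_variation M \<nu> E"
proof -
  have "(\<Sum>i. ennreal (norm (\<nu> (binaryset E {} i)))) = ennreal (norm (\<nu> E)) + 0"
    using vector_measure_empty[OF assms(1)] by (subst suminf_binaryset_eq) auto
  moreover have "(\<Sum>i. ennreal (norm (\<nu> (binaryset E {} i)))) \<le> total_variation M \<nu> E"
    using assms by (intro total_variation_upper)
      (auto simp: range_binaryset_eq UN_binaryset_eq disjoint_family_on_def binaryset_def)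
  ultimately show ?thesis by simp
qed

lemma total_variation_empty:
  assumes "vector_measure M \<nu>"
  shows "total_variation M \<nu> {} = 0"
proof -
  have "total_variation M \<nu> {} \<le> 0"
    unfolding total_variation_def
    by (intro SUP_least) (auto simp: vector_measure_empty[OF assms])
  then show ?thesis by simp
qed

text \<open>The first \<open>n\<close> terms of \<open>f\<close> and of \<open>g\<close> together
  are the first \<open>2 * n\<close> terms of \<open>h\<close>. This is used to merge a partition of
  one set with a partition of a disjoint set.\<close>

lemma suminf_interleave_ge:
  fixes f g h :: "nat \<Rightarrow> ennreal"
  assumes "\<And>n. h (2 * n) = f n" "\<And>n. h (2 * n + 1) = g n"
  shows "(\<Sum>n. f n) + (\<Sum>n. g n) \<le> (\<Sum>n. h n)"
proof -
  have "(\<Sum>i<n. f i) + (\<Sum>i<n. g i) = (\<Sum>i<2 * n. h i)" for n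
    using assms by (induction n) (simp_all add: algebra_simps)
  then have "(\<Sum>i<n. f i) + (\<Sum>i<n. g i) \<le> (\<Sum>n. h n)" for n
    by (simp add: sum_le_suminf)
  moreover have "(\<lambda>n. (\<Sum>i<n. f i) + (\<Sum>i<n. g i)) \<longlonglongrightarrow> (\<Sum>n. f n) + (\<Sum>n. g n)"
    by (intro tendsto_add summable_LIMSEQ) auto
  ultimately show ?thesis
    by (intro LIMSEQ_le_const2) auto
qed

text \<open>A partition of \<open>A\<close> and a partition of \<open>B\<close>, interleaved at even
  and odd indices, form a partition of the union. Taking suprema over the two partitions one after
  the other gives the inequality.\<close>

lemma total_variation_superadditive:
  assumes "A \<inter> B = {}" "A \<in> sets M" "B \<in> sets M"
  shows "total_variation M \<nu> A + total_variation M \<nu> B \<le> total_variation M \<nu> (A \<union> B)"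
proof -
  define parts where "parts E = {P :: nat \<Rightarrow> _. range P \<subseteq> sets M \<and> disjoint_family P \<and> (\<Union>i. P i) = E}" for E
  define v where "v P = (\<Sum>i::nat. ennreal (norm (\<nu> (P i))))" for P
  have tv: "total_variation M \<nu> E = (SUP P\<in>parts E. v P)" for E
    by (simp add: total_variation_def parts_def v_def)
  \<comment> \<open>A constant summand moves inside a supremum only over a nonempty index set; the
    trivial partition \<open>binaryset E {}\<close> provides a member.\<close>
  have ne: "parts E \<noteq> {}" if "E \<in> sets M" for E
  proof -
    have "binaryset E {} \<in> parts E"
      using that by (auto simp: parts_def range_binaryset_eq UN_binaryset_eq disjoint_family_on_def binaryset_def)
    then show ?thesis by blast
  qed
  have le: "v P + v Q \<le> total_variation M \<nu> (A \<union> B)" if P: "P \<in> parts A" and Q: "Q \<in> parts B" for P Q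
  proof -
    define R where "R n = (if even n then P (n div 2) else Q (n div 2))" for n
    have PA: "P i \<subseteq> A" and QB: "Q i \<subseteq> B" for i using P Q by (auto simp: parts_def)
    have "v P + v Q \<le> v R"
      unfolding v_def by (rule suminf_interleave_ge) (auto simp: R_def)
    also have "v R \<le> total_variation M \<nu> (A \<union> B)"
      unfolding v_def
    proof (rule total_variation_upper)
      show "range R \<subseteq> sets M" using P Q by (auto simp: R_def parts_def)
      show "disjoint_family R"
        unfolding disjoint_family_on_def
      proof (intro ballI impI)
        fix m n :: nat assume mn: "m \<noteq> n"
        have dP: "P i \<inter> P j = {}" "Q i \<inter> Q j = {}" if "i \<noteq> j" for i j
          using P Q that by (auto simp: parts_def disjoint_family_on_def)
        \<comment> \<open>Distinct indices of equal parity have distinct halves, so they pick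
          different members of the same partition. Indices of different parity pick subsets of
          \<open>A\<close> and of \<open>B\<close>, which are disjoint.\<close>
        have "m div 2 \<noteq> n div 2" if "even m = even n"
          using mn that by (metis bit_eq_rec)
        then show "R m \<inter> R n = {}"
          using dP PA QB assms(1) by (auto simp: R_def) blast+
      qed
      have "(\<Union>i. R i) = (\<Union>i. P i) \<union> (\<Union>i. Q i)"
      proof (intro equalityI subsetI)
        fix x assume "x \<in> (\<Union>i. P i) \<union> (\<Union>i. Q i)"
        then consider i where "x \<in> P i" | i where "x \<in> Q i" by blast
        then show "x \<in> (\<Union>i. R i)"
        proof cases
          case 1
          then have "x \<in> R (2 * i)" by (simp add: R_def)
          then show ?thesis by blast
        next
          case 2
          then have "x \<in> R (2 * i + 1)" by (simp add: R_def)
          then show ?thesis by blast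
        qed
      qed (auto simp: R_def split: if_splits)
      then show "(\<Union>i. R i) = A \<union> B" using P Q by (simp add: parts_def)
    qed
    finally show ?thesis .
  qed
  have "total_variation M \<nu> A + total_variation M \<nu> B = (SUP P\<in>parts A. v P + total_variation M \<nu> B)"
    unfolding tv[of A] using ne[OF assms(2)] by (simp add: ennreal_SUP_add_left)
  also have "\<dots> \<le> total_variation M \<nu> (A \<union> B)"
  proof (rule SUP_least)
    fix P assume P: "P \<in> parts A"
    have "v P + total_variation M \<nu> B = (SUP Q\<in>parts B. v P + v Q)"
      unfolding tv[of B] using ne[OF assms(3)] by (simp add: ennreal_SUP_add_right)
    also have "\<dots> \<le> total_variation M \<nu> (A \<union> B)"
      by (rule SUP_least) (rule le[OF P])
    finally show "v P + total_variation M \<nu> B \<le> total_variation M \<nu> (A \<union> B)" .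
  qed
  finally show ?thesis .
qed

lemma total_variation_mono:
  assumes "A \<subseteq> B" "A \<in> sets M" "B \<in> sets M"
  shows "total_variation M \<nu> A \<le> total_variation M \<nu> B"
proof -
  have "total_variation M \<nu> A \<le> total_variation M \<nu> A + total_variation M \<nu> (B - A)" by simp
  also have "\<dots> \<le> total_variation M \<nu> (A \<union> (B - A))"
    using assms by (intro total_variation_superadditive) auto
  also have "A \<union> (B - A) = B" using assms by auto
  finally show ?thesis .
qed

text \<open>One direction is superadditivity on finite unions followed by monotonicity. For the
  other, any partition \<open>P\<close> of the union is refined to the sets
  \<open>P j \<inter> A i\<close>; the norms can only increase in sum, and the double series is
  rearranged by columns.\<close>

lemma total_variation_countably_additive:
  fixes \<nu> :: "'a set \<Rightarrow> 'b::banach"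
  assumes \<nu>: "vector_measure M \<nu>"
  shows "countably_additive (sets M) (total_variation M \<nu>)"
proof (rule countably_additiveI)
  fix A :: "nat \<Rightarrow> 'a set"
  assume A: "range A \<subseteq> sets M" and disj: "disjoint_family A" and U: "(\<Union>i. A i) \<in> sets M"
  have Am: "A i \<in> sets M" for i using A by auto
  let ?tv = "total_variation M \<nu>"
  show "(\<Sum>i. ?tv (A i)) = ?tv (\<Union>i. A i)"
  proof (rule antisym)
    have "(\<Sum>i<n. ?tv (A i)) \<le> ?tv (\<Union>i<n. A i)" for n
    proof (induction n)
      case (Suc n)
      have "(\<Sum>i<Suc n. ?tv (A i)) \<le> ?tv (\<Union>i<n. A i) + ?tv (A n)"
        using Suc by (simp add: add_right_mono)
      also have "\<dots> \<le> ?tv ((\<Union>i<n. A i) \<union> A n)"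
      proof (rule total_variation_superadditive)
        show "(\<Union>i<n. A i) \<inter> A n = {}"
          using disj by (auto simp: disjoint_family_on_def) (metis IntI empty_iff less_irrefl)
      qed (use Am in auto)
      also have "(\<Union>i<n. A i) \<union> A n = (\<Union>i<Suc n. A i)"
        by (auto simp: less_Suc_eq)
      finally show ?case .
    qed (simp add: total_variation_empty[OF \<nu>])
    also have "?tv (\<Union>i<n. A i) \<le> ?tv (\<Union>i. A i)" for n
      using Am by (intro total_variation_mono) auto
    finally have le: "(\<Sum>i<n. ?tv (A i)) \<le> ?tv (\<Union>i. A i)" for n .
    show "(\<Sum>i. ?tv (A i)) \<le> ?tv (\<Union>i. A i)"
      by (rule suminf_le_const) (use le in auto)
  next
    show "?tv (\<Union>i. A i) \<le> (\<Sum>i. ?tv (A i))"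
      unfolding total_variation_def[of M \<nu> "\<Union>i. A i"]
    proof (rule SUP_least, clarify)
      fix P :: "nat \<Rightarrow> 'a set"
      assume P: "range P \<subseteq> sets M" "disjoint_family P" "(\<Union>i. P i) = (\<Union>i. A i)"
      have Pm: "P i \<in> sets M" for i using P by auto
      \<comment> \<open>If the refined norms have infinite sum there is nothing to show. Otherwise
        they are summable and the triangle inequality for infinite series applies.\<close>
      have 1: "ennreal (norm (\<nu> (P j))) \<le> (\<Sum>i. ennreal (norm (\<nu> (P j \<inter> A i))))" for j
      proof (cases "(\<Sum>i. ennreal (norm (\<nu> (P j \<inter> A i)))) = Orderings.top")
        case False
        then have sm: "summable (\<lambda>i. norm (\<nu> (P j \<inter> A i)))"
          by (intro summable_suminf_not_top) auto
        have "(\<lambda>i. \<nu> (P j \<inter> A i)) sums \<nu> (\<Union>i. P j \<inter> A i)"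
          using Pm Am disj by (intro vector_measureD[OF \<nu>]) (auto simp: disjoint_family_on_def, blast)
        also have "(\<Union>i. P j \<inter> A i) = P j" using P(3) by auto
        finally have "norm (\<nu> (P j)) \<le> (\<Sum>i. norm (\<nu> (P j \<inter> A i)))"
          using summable_norm[OF sm] by (simp add: sums_iff)
        then have "ennreal (norm (\<nu> (P j))) \<le> ennreal (\<Sum>i. norm (\<nu> (P j \<inter> A i)))"
          by (rule ennreal_leI)
        also have "\<dots> = (\<Sum>i. ennreal (norm (\<nu> (P j \<inter> A i))))"
          by (rule suminf_ennreal_eq[symmetric]) (use sm in \<open>auto simp: summable_sums\<close>)
        finally show ?thesis .
      qed simp
      have "(\<Sum>j. ennreal (norm (\<nu> (P j)))) \<le> (\<Sum>j. \<Sum>i. ennreal (norm (\<nu> (P j \<inter> A i))))"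
        using 1 by (intro suminf_le) auto
      \<comment> \<open>The order of summation is exchanged by reading the outer sum as an integral
        against counting measure.\<close>
      also have "\<dots> = (\<integral>\<^sup>+j. (\<Sum>i. ennreal (norm (\<nu> (P j \<inter> A i)))) \<partial>count_space UNIV)"
        by (simp add: nn_integral_count_space_nat)
      also have "\<dots> = (\<Sum>i. \<integral>\<^sup>+j. ennreal (norm (\<nu> (P j \<inter> A i))) \<partial>count_space UNIV)"
        by (rule nn_integral_suminf) simp
      also have "\<dots> = (\<Sum>i. \<Sum>j. ennreal (norm (\<nu> (P j \<inter> A i))))"
        by (simp add: nn_integral_count_space_nat)
      also have "\<dots> \<le> (\<Sum>i. ?tv (A i))"
      proof (rule suminf_le)
        fix i
        show "(\<Sum>j. ennreal (norm (\<nu> (P j \<inter> A i)))) \<le> ?tv (A i)"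
          using Pm Am P by (intro total_variation_upper) (auto simp: disjoint_family_on_def, blast)
      qed auto
      finally show "(\<Sum>j. ennreal (norm (\<nu> (P j)))) \<le> (\<Sum>i. ?tv (A i))" .
    qed
  qed
qed

text \<open>
  Finiteness of the variation follows Rudin: a set of infinite variation splits into two pieces of
  large measure, one of which again has infinite variation, and iterating contradicts convergence.
\<close>

lemma total_variation_top_split:
  fixes \<nu> :: "'a set \<Rightarrow> 'b::euclidean_space"
  assumes \<nu>: "vector_measure M \<nu>" and E: "E \<in> sets M" and top: "total_variation M \<nu> E = Orderings.top"
  obtains A where "A \<in> sets M" "A \<subseteq> E" "norm (\<nu> A) > 1" "norm (\<nu> (E - A)) > 1"
proof -
  \<comment> \<open>With this \<open>e\<close>, any \<open>A\<close> with
    \<open>norm (\<nu> A) > e\<close> also leaves a complement of norm at least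
    \<open>norm (\<nu> A) - norm (\<nu> E) > 1\<close>.\<close>
  define e where "e = 1 + norm (\<nu> E)"
  have e0: "e \<ge> 1" by (simp add: e_def)
  \<comment> \<open>If all finite subset sums have norm at most \<open>e\<close>, then the sum of
    the norms is at most \<open>2 * DIM('b) * e\<close>. Exceeding this threshold therefore yields a
    subset \<open>S\<close> whose sum has norm above \<open>e\<close>.\<close>
  define T where "T = 2 * real DIM('b) * e"
  have "ennreal T < total_variation M \<nu> E" using top by simp
  then obtain P where P: "range P \<subseteq> sets M" "disjoint_family P" "(\<Union>i. P i) = E"
    and PT: "ennreal T < (\<Sum>i::nat. ennreal (norm (\<nu> (P i))))"
    unfolding total_variation_def by (auto simp: less_SUP_iff)
  obtain n where n: "ennreal T < (\<Sum>i<n. ennreal (norm (\<nu> (P i))))"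
    using PT by (auto simp: suminf_eq_SUP less_SUP_iff)
  then have nT: "T < (\<Sum>i<n. norm (\<nu> (P i)))"
    by (simp add: sum_ennreal ennreal_less_iff T_def e_def)
  have "\<exists>S\<subseteq>{..<n}. norm (\<Sum>i\<in>S. \<nu> (P i)) > e"
  proof (rule ccontr)
    assume "\<not> ?thesis"
    then have "(\<Sum>i<n. norm (\<nu> (P i))) \<le> 2 * real DIM('b) * e"
      by (intro sum_norm_allsubsets_bound) (auto simp: not_less)
    then show False using nT by (simp add: T_def)
  qed
  then obtain S where S: "S \<subseteq> {..<n}" "norm (\<Sum>i\<in>S. \<nu> (P i)) > e" by blast
  have fS: "finite S" using S finite_subset by blast
  define A where "A = (\<Union>i\<in>S. P i)"
  have "\<nu> A = (\<Sum>i\<in>S. \<nu> (P i))"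
    unfolding A_def using P fS
    by (intro vector_measure_UN_finite[OF \<nu>]) (auto simp: disjoint_family_on_def)
  with S have nA: "norm (\<nu> A) > e" by simp
  have A: "A \<in> sets M" "A \<subseteq> E" using P fS by (auto simp: A_def)
  have "\<nu> (E - A) = \<nu> E - \<nu> A" by (rule vector_measure_Diff[OF \<nu> A(1) E A(2)])
  moreover have "norm (\<nu> A) \<le> norm (\<nu> E - \<nu> A) + norm (\<nu> E)"
    by (metis norm_minus_commute norm_triangle_sub add.commute)
  ultimately have "norm (\<nu> (E - A)) > 1" using nA by (simp add: e_def)
  then show ?thesis using that[OF A] nA e0 by linarith
qed

lemma total_variation_finite:
  fixes \<nu> :: "'a set \<Rightarrow> 'b::euclidean_space"
  assumes \<nu>: "vector_measure M \<nu>" and E0: "E0 \<in> sets M"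
  shows "total_variation M \<nu> E0 < Orderings.top"
proof (rule ccontr)
  let ?tv = "total_variation M \<nu>"
  assume "\<not> ?tv E0 < Orderings.top"
  then have top0: "?tv E0 = Orderings.top" using top.not_eq_extremum by blast
  have additive: "?tv (A \<union> B) = ?tv A + ?tv B" if "A \<in> sets M" "B \<in> sets M" "A \<inter> B = {}" for A B
    using sets.countably_additive_additive[OF _ total_variation_countably_additive[OF \<nu>]] that
      total_variation_empty[OF \<nu>]
    by (auto simp: positive_def additive_def)
  define Q where "Q E \<longleftrightarrow> E \<in> sets M \<and> ?tv E = Orderings.top" for E
  have step: "\<exists>A. Q A \<and> A \<subseteq> E \<and> norm (\<nu> (E - A)) > 1" if "Q E" for E
  proof -
    obtain A where A: "A \<in> sets M" "A \<subseteq> E" "norm (\<nu> A) > 1" "norm (\<nu> (E - A)) > 1"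
      using total_variation_top_split[OF \<nu>] \<open>Q E\<close> by (auto simp: Q_def)
    have "?tv (A \<union> (E - A)) = ?tv A + ?tv (E - A)"
      using A that by (intro additive) (auto simp: Q_def)
    moreover have "A \<union> (E - A) = E" "E - (E - A) = A" using A by auto
    ultimately have "?tv A = Orderings.top \<or> ?tv (E - A) = Orderings.top"
      using that by (metis Q_def ennreal_add_eq_top)
    then show ?thesis
    proof
      assume "?tv A = Orderings.top" then show ?thesis using A by (auto simp: Q_def)
    next
      assume "?tv (E - A) = Orderings.top"
      then show ?thesis using A that \<open>E - (E - A) = A\<close>
        by (intro exI[of _ "E - A"]) (auto simp: Q_def)
    qed
  qed
  obtain F where F: "\<And>n. Q (F n)" "\<And>n. F (Suc n) \<subseteq> F n \<and> norm (\<nu> (F n - F (Suc n))) > 1"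
    using dependent_nat_choice[of "\<lambda>_. Q" "\<lambda>_ E A. A \<subseteq> E \<and> norm (\<nu> (E - A)) > 1"]
      step top0 E0 by (metis Q_def)
  have dec: "decseq F" using F(2) by (simp add: decseq_Suc_iff)
  \<comment> \<open>The successive differences of a decreasing sequence are disjoint. Their measures
    form a convergent series, yet every term has norm above 1.\<close>
  define D where "D n = F n - F (Suc n)" for n
  have "disjoint_family D"
    unfolding disjoint_family_on_def
  proof (intro ballI impI)
    fix m n :: nat assume "m \<noteq> n"
    then consider "Suc m \<le> n" | "Suc n \<le> m" by linarith
    then show "D m \<inter> D n = {}"
    proof cases
      case 1 then show ?thesis using decseqD[OF dec 1] by (auto simp: D_def)
    next
      case 2 then show ?thesis using decseqD[OF dec 2] by (auto simp: D_def)
    qed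
  qed
  moreover have "range D \<subseteq> sets M" using F(1) by (auto simp: D_def Q_def)
  ultimately have "(\<lambda>n. \<nu> (D n)) sums \<nu> (\<Union>n. D n)"
    by (intro vector_measureD[OF \<nu>])
  then have "(\<lambda>n. \<nu> (D n)) \<longlonglongrightarrow> 0" using sums_summable summable_LIMSEQ_zero by blast
  then have "eventually (\<lambda>n. norm (\<nu> (D n)) < 1) sequentially"
    by (simp add: tendsto_iff)
  then obtain n where "norm (\<nu> (D n)) < 1" by (auto simp: eventually_sequentially)
  then show False using F(2)[of n] by (simp add: D_def)
qed

section \<open>The variation as a finite positive measure\<close>

definition variation_measure :: "'a measure \<Rightarrow> ('a set \<Rightarrow> 'b::real_normed_vector) \<Rightarrow> 'a measure" where
  "variation_measure M \<nu> = measure_of (space M) (sets M) (total_variation M \<nu>)"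

lemma sets_variation_measure [simp, measurable_cong]: "sets (variation_measure M \<nu>) = sets M"
  and space_variation_measure [simp]: "space (variation_measure M \<nu>) = space M"
  by (simp_all add: variation_measure_def)

lemma emeasure_variation_measure:
  fixes \<nu> :: "'a set \<Rightarrow> 'b::banach"
  assumes "vector_measure M \<nu>" "E \<in> sets M"
  shows "emeasure (variation_measure M \<nu>) E = total_variation M \<nu> E"
proof -
  have "positive (sets M) (total_variation M \<nu>)"
    by (simp add: positive_def total_variation_empty[OF assms(1)])
  then show ?thesis
    using assms total_variation_countably_additive[OF assms(1)]
    by (simp add: variation_measure_def emeasure_measure_of_sigma sets.sigma_algebra_axioms)
qed

lemma finite_variation_measure:
  fixes \<nu> :: "'a set \<Rightarrow> 'b::euclidean_space"
  assumes "vector_measure M \<nu>"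
  shows "finite_measure (variation_measure M \<nu>)"
  using total_variation_finite[OF assms] emeasure_variation_measure[OF assms]
  by (intro finite_measureI) (auto simp: less_top)

lemma total_variation_uminus: "total_variation M (\<lambda>E. - \<nu> E) = total_variation M \<nu>"
  by (rule ext) (simp add: total_variation_def)

subsection \<open>Complex measures on the circle\<close>

lemma complex_measure_iff:
  "complex_measure M \<mu> \<longleftrightarrow> vector_measure M \<mu> \<and> (\<forall>E. E \<notin> sets M \<longrightarrow> \<mu> E = 0)"
  by (simp add: complex_measure_def vector_measure_def)

lemma sets_circle_borel: "E \<in> sets circle_borel \<longleftrightarrow> E \<in> sets borel \<and> E \<subseteq> circle"
  by (subst sets_restrict_space_iff) auto

lemma space_circle_borel [simp]: "space circle_borel = circle"
  by (simp add: space_restrict_space)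

text \<open>Finite Borel measures on the plane are inner and outer regular. The variation is pushed
  forward along the inclusion of the circle into the plane, and the two regularity formulas are read
  back on the circle.\<close>

lemma complex_measure_regular_on_circle:
  assumes "complex_measure circle_borel \<mu>"
  shows "regular_on_circle \<mu>"
proof -
  have \<mu>: "vector_measure circle_borel \<mu>" using assms by (simp add: complex_measure_iff)
  let ?tv = "total_variation circle_borel \<mu>"
  define N where "N = distr (variation_measure circle_borel \<mu>) borel (\<lambda>x. x)"
  have meas: "(\<lambda>x. x) \<in> measurable (variation_measure circle_borel \<mu>) borel"
    by (subst measurable_cong_sets[OF sets_variation_measure refl])
      (simp add: measurable_restrict_space1)
  have N: "emeasure N B = ?tv (B \<inter> circle)" if "B \<in> sets borel" for B
    unfolding N_def using that meas
    by (simp add: emeasure_distr emeasure_variation_measure[OF \<mu>] sets_circle_borel)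
  interpret V: finite_measure "variation_measure circle_borel \<mu>"
    by (rule finite_variation_measure[OF \<mu>])
  have fin: "emeasure N (space N) \<noteq> \<infinity>"
    unfolding N_def using meas by (simp add: emeasure_distr)
  have sets_N: "sets N = sets borel" by (simp add: N_def)
  show ?thesis
    unfolding regular_on_circle_def
  proof (intro ballI conjI)
    fix E assume "E \<in> sets circle_borel"
    then have E: "E \<in> sets borel" "E \<subseteq> circle" by (auto simp: sets_circle_borel)
    then have NE: "emeasure N E = ?tv E" by (simp add: N Int_absorb2)
    \<comment> \<open>The relatively open subsets of the circle are the traces of open subsets of
      the plane, and the push-forward \<open>N\<close> sees only the trace.\<close>
    have "(\<lambda>U. emeasure N U) ` {U. E \<subseteq> U \<and> open U} = ?tv ` {U. openin (top_of_set circle) U \<and> E \<subseteq> U}"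
    proof (intro equalityI subsetI)
      fix t assume "t \<in> (\<lambda>U. emeasure N U) ` {U. E \<subseteq> U \<and> open U}"
      then obtain U where "E \<subseteq> U" "open U" "t = ?tv (U \<inter> circle)" by (auto simp: N)
      then show "t \<in> ?tv ` {U. openin (top_of_set circle) U \<and> E \<subseteq> U}"
        using E by (auto simp: openin_open)
    next
      fix t assume "t \<in> ?tv ` {U. openin (top_of_set circle) U \<and> E \<subseteq> U}"
      then obtain U where "open U" "E \<subseteq> circle \<inter> U" "t = ?tv (circle \<inter> U)" by (auto simp: openin_open)
      then show "t \<in> (\<lambda>U. emeasure N U) ` {U. E \<subseteq> U \<and> open U}"
        by (intro image_eqI[of _ _ U]) (auto simp: N Int_commute)
    qed
    then show "?tv E = (INF U\<in>{U. openin (top_of_set circle) U \<and> E \<subseteq> U}. ?tv U)"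
      using outer_regular[OF sets_N fin E(1)] NE by simp
    have "?tv K = emeasure N K" if "compact K" "K \<subseteq> E" for K
      using that E by (subst N) (auto simp: borel_compact Int_absorb2)
    then show "?tv E = (SUP K\<in>{K. compact K \<and> K \<subseteq> E}. ?tv K)"
      using inner_regular[OF sets_N fin E(1)] NE by (simp add: conj_commute)
  qed
qed

lemma carrier_circle_measure_algebra:
  "carrier circle_measure_algebra = {\<mu>. complex_measure circle_borel \<mu>}"
  by (auto simp: circle_measure_algebra_def complex_measure_regular_on_circle)

text \<open>The four Jordan parts \<open>m\<^sub>j\<close> of \<open>\<mu>\<close>, indexed so that \<open>\<mu> = (\<Sum>j<4. \<i>\<^sup>j m\<^sub>j)\<close>.\<close>

definition jordan :: "'a measure \<Rightarrow> ('a set \<Rightarrow> complex) \<Rightarrow> nat \<Rightarrow> 'a measure" where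
  "jordan M \<mu> j = pos_part_measure M
     (\<lambda>E. if j = 0 then Re (\<mu> E) else if j = 1 then Im (\<mu> E) else if j = 2 then - Re (\<mu> E) else - Im (\<mu> E))"

text \<open>The powers of \<open>\<i>\<close> for \<open>j = 0, 1, 2, 3\<close> are the coefficients
  of the positive parts of \<open>Re\<close>, \<open>Im\<close>, \<open>- Re\<close> and
  \<open>- Im\<close>. The uniform sum lets linearity arguments be made once for all four
  parts.\<close>

lemma complex_measure_integral_jordan:
  "complex_measure_integral M \<mu> f = (\<Sum>j<4. \<i> ^ j * integral\<^sup>L (jordan M \<mu> j) f)"
  by (simp add: complex_measure_integral_def real_measure_integral_def jordan_def
      eval_nat_numeral algebra_simps)

section \<open>The Jordan parts as finite positive measures\<close>

lemma sets_pos_part_measure [simp, measurable_cong]: "sets (pos_part_measure M \<nu>) = sets M"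
  and space_pos_part_measure [simp]: "space (pos_part_measure M \<nu>) = space M"
  by (simp_all add: pos_part_measure_def)

lemma sets_jordan [simp, measurable_cong]: "sets (jordan M \<mu> j) = sets M"
  and space_jordan [simp]: "space (jordan M \<mu> j) = space M"
  by (simp_all add: jordan_def)

text \<open>The set function given to \<open>measure_of\<close> is nonnegative because
  \<open>\<bar>\<nu> E\<bar>\<close> is at most the variation of \<open>E\<close>, and countably
  additive because \<open>\<nu>\<close> and its finite variation both are. Hence it really is the
  resulting measure.\<close>

lemma emeasure_pos_part_measure:
  assumes \<nu>: "vector_measure M (\<nu> :: 'a set \<Rightarrow> real)" and E: "E \<in> sets M"
  shows "emeasure (pos_part_measure M \<nu>) E = ennreal ((enn2real (total_variation M \<nu> E) + \<nu> E) / 2)"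
proof -
  interpret finite_measure "variation_measure M \<nu>" by (rule finite_variation_measure[OF \<nu>])
  define p where "p E = (enn2real (total_variation M \<nu> E) + \<nu> E) / 2" for E
  have tv: "enn2real (total_variation M \<nu> A) = measure (variation_measure M \<nu>) A" if "A \<in> sets M" for A
    using that by (simp add: measure_def emeasure_variation_measure[OF \<nu>])
  have nonneg: "0 \<le> p A" if "A \<in> sets M" for A
  proof -
    have "ennreal \<bar>\<nu> A\<bar> \<le> ennreal (measure (variation_measure M \<nu>) A)"
      using total_variation_norm_le[OF \<nu> that] that
      by (simp add: emeasure_variation_measure[OF \<nu>] flip: emeasure_eq_measure)
    then show ?thesis using tv[OF that] by (simp add: p_def ennreal_le_iff)
  qed
  have "countably_additive (sets M) (\<lambda>E. ennreal (p E))"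
  proof (rule countably_additiveI)
    fix A :: "nat \<Rightarrow> 'a set"
    assume A: "range A \<subseteq> sets M" "disjoint_family A" "(\<Union>i. A i) \<in> sets M"
    have "(\<lambda>i. (measure (variation_measure M \<nu>) (A i) + \<nu> (A i)) / 2) sums
        ((measure (variation_measure M \<nu>) (\<Union>i. A i) + \<nu> (\<Union>i. A i)) / 2)"
      using A by (intro sums_divide sums_add vector_measureD[OF \<nu>] finite_measure_UNION) auto
    moreover have "A i \<in> sets M" for i using A by auto
    ultimately have "(\<lambda>i. p (A i)) sums p (\<Union>i. A i)"
      using A by (simp add: p_def tv)
    then show "(\<Sum>i. ennreal (p (A i))) = ennreal (p (\<Union>i. A i))"
      using A nonneg by (intro suminf_ennreal_eq) auto
  qed
  moreover have "positive (sets M) (\<lambda>E. ennreal (p E))"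
    by (simp add: positive_def p_def total_variation_empty[OF \<nu>] vector_measure_empty[OF \<nu>])
  ultimately show ?thesis
    using E unfolding p_def
    by (simp add: pos_part_measure_def emeasure_measure_of_sigma sets.sigma_algebra_axioms)
qed

lemma finite_pos_part_measure:
  assumes "vector_measure M (\<nu> :: 'a set \<Rightarrow> real)"
  shows "finite_measure (pos_part_measure M \<nu>)"
  by (intro finite_measureI) (simp add: emeasure_pos_part_measure[OF assms])

lemma vector_measure_uminus:
  "vector_measure M \<nu> \<Longrightarrow> vector_measure M (\<lambda>E. - \<nu> E)"
  by (simp add: vector_measure_def sums_minus)

text \<open>Since \<open>\<nu>\<close> and \<open>-\<nu>\<close> have the same variation
  \<open>v\<close>, the difference is \<open>(v + \<nu>) / 2 - (v - \<nu>) / 2\<close>.\<close>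

lemma measure_pos_part_diff:
  assumes \<nu>: "vector_measure M (\<nu> :: 'a set \<Rightarrow> real)" and E: "E \<in> sets M"
  shows "\<nu> E = measure (pos_part_measure M \<nu>) E - measure (pos_part_measure M (\<lambda>E. - \<nu> E)) E"
proof -
  have le: "\<bar>\<nu> E\<bar> \<le> enn2real (total_variation M \<nu> E)"
    using total_variation_norm_le[OF \<nu> E] total_variation_finite[OF \<nu> E]
    by (metis abs_ge_zero enn2real_ennreal enn2real_mono real_norm_def)
  then show ?thesis
    using emeasure_pos_part_measure[OF \<nu> E]
      emeasure_pos_part_measure[OF vector_measure_uminus[OF \<nu>] E]
    by (simp add: measure_def total_variation_uminus field_simps)
qed

lemma vector_measure_Re: "vector_measure M \<mu> \<Longrightarrow> vector_measure M (\<lambda>E. Re (\<mu> E))"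
  and vector_measure_Im: "vector_measure M \<mu> \<Longrightarrow> vector_measure M (\<lambda>E. Im (\<mu> E))"
  by (simp_all add: vector_measure_def sums_Re sums_Im)

lemma finite_jordan:
  "vector_measure M \<mu> \<Longrightarrow> finite_measure (jordan M \<mu> j)"
  unfolding jordan_def
  by (cases "j = 0"; cases "j = 1"; cases "j = 2")
    (simp_all add: finite_pos_part_measure vector_measure_Re vector_measure_Im vector_measure_uminus)

lemma jordan_sum:
  assumes "vector_measure M \<mu>" "E \<in> sets M"
  shows "\<mu> E = (\<Sum>j<4. \<i> ^ j * complex_of_real (measure (jordan M \<mu> j) E))"
  using measure_pos_part_diff[OF vector_measure_Re[OF assms(1)] assms(2)]
    measure_pos_part_diff[OF vector_measure_Im[OF assms(1)] assms(2)]
  by (simp add: jordan_def eval_nat_numeral complex_eq_iff)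

subsection \<open>Convolution\<close>

abbreviation translate :: "complex set \<Rightarrow> complex \<Rightarrow> complex set" where
  "translate E y \<equiv> {x \<in> circle. x * y \<in> E}"

lemma measurable_circle_mult:
  "(\<lambda>(y, x). x * y) \<in> measurable (circle_borel \<Otimes>\<^sub>M circle_borel) circle_borel"
proof (rule measurable_restrict_space2)
  have "fst \<in> measurable (circle_borel \<Otimes>\<^sub>M circle_borel) borel"
    by (rule measurable_compose[OF measurable_fst]) (simp add: measurable_restrict_space1)
  moreover have "snd \<in> measurable (circle_borel \<Otimes>\<^sub>M circle_borel) borel"
    by (rule measurable_compose[OF measurable_snd]) (simp add: measurable_restrict_space1)
  ultimately show "(\<lambda>(y, x). x * y) \<in> borel_measurable (circle_borel \<Otimes>\<^sub>M circle_borel)"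
    by (simp add: case_prod_beta')
qed (auto simp: space_pair_measure norm_mult)

lemma sets_translate:
  assumes "E \<in> sets circle_borel" "y \<in> circle"
  shows "translate E y \<in> sets circle_borel"
proof -
  have "(\<lambda>x. (y, x)) \<in> measurable circle_borel (circle_borel \<Otimes>\<^sub>M circle_borel)"
    using assms(2) by (intro measurable_Pair1') simp
  from measurable_sets[OF measurable_compose[OF this measurable_circle_mult] assms(1)]
  show ?thesis by (simp add: vimage_def Int_def conj_commute)
qed

text \<open>The classical convolution of positive measures, as the image of the product measure
  under multiplication. The factor \<open>n\<close> comes first because \<open>convolution\<close>
  integrates over its second argument, which is the outer variable.\<close>

definition pair_conv :: "complex measure \<Rightarrow> complex measure \<Rightarrow> complex measure" where
  "pair_conv m n = distr (n \<Otimes>\<^sub>M m) circle_borel (\<lambda>(y, x). x * y)"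

context
  fixes m :: "complex measure"
  assumes fin_m: "finite_measure m" and sets_m: "sets m = sets circle_borel"
begin

text \<open>The set \<open>translate E y\<close> is the section at \<open>y\<close> of the preimage
  of \<open>E\<close> under multiplication, and the measure of a section depends measurably on
  \<open>y\<close>.\<close>

lemma measurable_measure_translate:
  assumes "E \<in> sets circle_borel"
  shows "(\<lambda>y. measure m (translate E y)) \<in> borel_measurable circle_borel"
proof -
  interpret finite_measure m by (rule fin_m)
  define Q where "Q = (\<lambda>(y, x). x * y) -` E \<inter> space (circle_borel \<Otimes>\<^sub>M circle_borel)"
  have "Q \<in> sets (circle_borel \<Otimes>\<^sub>M m)"
    unfolding Q_def using measurable_sets[OF measurable_circle_mult assms] sets_m
    by (simp cong: sets_pair_measure_cong)
  then have "(\<lambda>y. emeasure m (Pair y -` Q)) \<in> borel_measurable circle_borel"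
    by (rule measurable_emeasure_Pair)
  moreover have "Pair y -` Q = translate E y" if "y \<in> space circle_borel" for y
    using that by (auto simp: Q_def space_pair_measure)
  ultimately have "(\<lambda>y. emeasure m (translate E y)) \<in> borel_measurable circle_borel"
    by (subst measurable_cong[where g = "\<lambda>y. emeasure m (Pair y -` Q)"]) auto
  then show ?thesis unfolding measure_def by measurable
qed

lemma integrable_measure_translate:
  assumes "finite_measure n" "sets n = sets circle_borel" "E \<in> sets circle_borel"
  shows "integrable n (\<lambda>y. measure m (translate E y))"
proof -
  interpret finite_measure n by fact
  have "(\<lambda>y. measure m (translate E y)) \<in> borel_measurable n"
    using measurable_measure_translate[OF assms(3)] assms(2) by (simp cong: measurable_cong_sets)
  then show ?thesis
    by (intro integrable_const_bound[where B = "measure m (space m)"])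
      (auto intro!: AE_I2 finite_measure.bounded_measure[OF fin_m])
qed

lemma finite_pair_conv:
  assumes "finite_measure n" "sets n = sets circle_borel"
  shows "finite_measure (pair_conv m n)"
proof -
  have "finite_measure (n \<Otimes>\<^sub>M m)"
    using fin_m assms(1) by (rule finite_measure_pair_measure)
  moreover have "(\<lambda>(y, x). x * y) \<in> measurable (n \<Otimes>\<^sub>M m) circle_borel"
    using measurable_circle_mult sets_m assms(2)
    by (subst measurable_cong_sets[OF sets_pair_measure_cong refl]) auto
  ultimately show ?thesis
    unfolding pair_conv_def by (rule finite_measure.finite_measure_distr)
qed

text \<open>Product measure is computed by sections: the section at \<open>y\<close> of the preimage
  of \<open>E\<close> is \<open>translate E y\<close>. Integrability then allows passing from
  \<open>ennreal\<close> to real integrals.\<close>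

lemma measure_pair_conv:
  assumes "finite_measure n" "sets n = sets circle_borel" "E \<in> sets circle_borel"
  shows "measure (pair_conv m n) E = (\<integral>y. measure m (translate E y) \<partial>n)"
proof -
  interpret n: finite_measure n by fact
  interpret m: finite_measure m by (rule fin_m)
  interpret c: finite_measure "pair_conv m n" using assms by (intro finite_pair_conv)
  have sp: "space n = circle" "space m = circle"
    using sets_eq_imp_space_eq[OF assms(2)] sets_eq_imp_space_eq[OF sets_m] by simp_all
  have mult: "(\<lambda>(y, x). x * y) \<in> measurable (n \<Otimes>\<^sub>M m) circle_borel"
    using measurable_circle_mult sets_m assms(2)
    by (subst measurable_cong_sets[OF sets_pair_measure_cong refl]) auto
  define Q where "Q = (\<lambda>(y, x). x * y) -` E \<inter> space (n \<Otimes>\<^sub>M m)"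
  have Q: "Q \<in> sets (n \<Otimes>\<^sub>M m)"
    unfolding Q_def by (rule measurable_sets[OF mult assms(3)])
  have "ennreal (measure (pair_conv m n) E) = emeasure (n \<Otimes>\<^sub>M m) Q"
    unfolding c.emeasure_eq_measure[symmetric] Q_def
    using assms(3) mult by (simp add: pair_conv_def emeasure_distr)
  also have "\<dots> = (\<integral>\<^sup>+y. emeasure m (Pair y -` Q) \<partial>n)"
    by (rule m.emeasure_pair_measure_alt[OF Q])
  also have "\<dots> = (\<integral>\<^sup>+y. ennreal (measure m (translate E y)) \<partial>n)"
  proof (rule nn_integral_cong)
    fix y assume "y \<in> space n"
    then have "Pair y -` Q = translate E y" by (auto simp: Q_def space_pair_measure sp)
    then show "emeasure m (Pair y -` Q) = ennreal (measure m (translate E y))"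
      by (simp add: m.emeasure_eq_measure)
  qed
  also have "\<dots> = ennreal (\<integral>y. measure m (translate E y) \<partial>n)"
    by (intro nn_integral_eq_integral integrable_measure_translate assms) auto
  finally show ?thesis by (simp add: integral_nonneg_AE)
qed

end

section \<open>Convolution of complex measures\<close>

lemma borel_measurable_translate:
  assumes "vector_measure circle_borel \<mu>" "E \<in> sets circle_borel"
  shows "(\<lambda>y. \<mu> (translate E y) :: complex) \<in> borel_measurable circle_borel"
proof -
  have "(\<lambda>y. \<Sum>j<4. \<i> ^ j * complex_of_real (measure (jordan circle_borel \<mu> j) (translate E y)))
      \<in> borel_measurable circle_borel"
    using measurable_measure_translate[OF finite_jordan[OF assms(1)] sets_jordan assms(2)]
    by measurable
  then show ?thesis
  proof (rule measurable_cong[THEN iffD2, rotated])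
    fix y assume "y \<in> space circle_borel"
    then have "y \<in> circle" by simp
    from jordan_sum[OF assms(1) sets_translate[OF assms(2) this]]
    show "\<mu> (translate E y)
      = (\<Sum>j<4. \<i> ^ j * complex_of_real (measure (jordan circle_borel \<mu> j) (translate E y)))" .
  qed
qed

text \<open>Splitting both factors into Jordan parts reduces \<open>convolution\<close> to sixteen
  convolutions of finite positive measures. Countable additivity of the convolution is read off from
  this sum.\<close>

lemma convolution_eq_sum:
  assumes \<mu>: "vector_measure circle_borel \<mu>" and \<nu>: "vector_measure circle_borel \<nu>"
    and E: "E \<in> sets circle_borel"
  shows "convolution \<mu> \<nu> E = (\<Sum>k<4. \<Sum>j<4. \<i> ^ k * \<i> ^ j *
    complex_of_real (measure (pair_conv (jordan circle_borel \<mu> j) (jordan circle_borel \<nu> k)) E))"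
proof -
  let ?m = "jordan circle_borel \<mu>" and ?n = "jordan circle_borel \<nu>"
  have "(\<integral>y. \<mu> (translate E y) \<partial>?n k)
      = (\<Sum>j<4. \<i> ^ j * complex_of_real (measure (pair_conv (?m j) (?n k)) E))" for k
  proof -
    have int: "integrable (?n k) (\<lambda>y. measure (?m j) (translate E y))" for j
      by (intro integrable_measure_translate finite_jordan \<mu> \<nu> sets_jordan E)
    have "(\<integral>y. \<mu> (translate E y) \<partial>?n k)
        = (\<integral>y. (\<Sum>j<4. \<i> ^ j * complex_of_real (measure (?m j) (translate E y))) \<partial>?n k)"
      by (intro Bochner_Integration.integral_cong refl jordan_sum[OF \<mu>] sets_translate E) simp
    also have "\<dots> = (\<Sum>j<4. \<i> ^ j * complex_of_real (\<integral>y. measure (?m j) (translate E y) \<partial>?n k))"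
      using int by (subst Bochner_Integration.integral_sum) (auto intro!: integrable_mult_right integrable_of_real)
    also have "\<dots> = (\<Sum>j<4. \<i> ^ j * complex_of_real (measure (pair_conv (?m j) (?n k)) E))"
      by (subst measure_pair_conv[OF finite_jordan[OF \<mu>] sets_jordan finite_jordan[OF \<nu>] sets_jordan E]) simp
    finally show ?thesis .
  qed
  then show ?thesis
    using E by (simp add: convolution_def complex_measure_integral_jordan sum_distrib_left mult.assoc)
qed

lemma vector_measure_finite_measure:
  assumes "finite_measure m" "sets m = sets M"
  shows "vector_measure M (measure m)"
  unfolding vector_measure_def
  using finite_measure.finite_measure_UNION[OF assms(1)] assms(2) by simp

lemma vector_measure_cong:
  assumes "\<And>E. E \<in> sets M \<Longrightarrow> \<mu> E = \<nu> E" "vector_measure M \<mu>"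
  shows "vector_measure M \<nu>"
  unfolding vector_measure_def
proof (intro allI impI)
  fix E :: "nat \<Rightarrow> 'a set" assume E: "range E \<subseteq> sets M" "disjoint_family E"
  have "E i \<in> sets M" for i using E(1) by auto
  then show "(\<lambda>i. \<nu> (E i)) sums \<nu> (\<Union>i. E i)"
    using vector_measureD[OF assms(2) E] by (simp add: assms(1) sets.countable_UN)
qed

lemma complex_measure_convolution:
  assumes \<mu>: "vector_measure circle_borel \<mu>" and \<nu>: "vector_measure circle_borel \<nu>"
  shows "complex_measure circle_borel (convolution \<mu> \<nu>)"
  unfolding complex_measure_iff
proof
  let ?m = "jordan circle_borel \<mu>" and ?n = "jordan circle_borel \<nu>"
  have pc: "vector_measure circle_borel (measure (pair_conv (?m j) (?n k)))" for j k
    by (intro vector_measure_finite_measure finite_pair_conv finite_jordan \<mu> \<nu> sets_jordan)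
      (simp add: pair_conv_def)
  have "vector_measure circle_borel (\<lambda>E. \<Sum>k<4. \<Sum>j<4. \<i> ^ k * \<i> ^ j *
      complex_of_real (measure (pair_conv (?m j) (?n k)) E))"
    unfolding vector_measure_def
    by (intro allI impI sums_sum sums_mult sums_of_real vector_measureD[OF pc])
  then show "vector_measure circle_borel (convolution \<mu> \<nu>)"
    by (rule vector_measure_cong[rotated]) (simp add: convolution_eq_sum[OF \<mu> \<nu>])
qed (simp add: convolution_def)

subsection \<open>The measure algebra and its point masses\<close>

text \<open>For a positive measure every partition sum equals the measure of the whole set. It
  follows that the positive part of such a measure is itself and its negative part vanishes, which
  makes integrals against point masses computable.\<close>

lemma total_variation_finite_measure:
  assumes "finite_measure m" "sets m = sets M" "E \<in> sets M"
  shows "total_variation M (measure m) E = ennreal (measure m E)"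
proof (rule antisym)
  have m: "vector_measure M (measure m)" by (rule vector_measure_finite_measure[OF assms(1,2)])
  then show "ennreal (measure m E) \<le> total_variation M (measure m) E"
    using total_variation_norm_le[OF m assms(3)] by simp
  show "total_variation M (measure m) E \<le> ennreal (measure m E)"
    unfolding total_variation_def
  proof (rule SUP_least, clarify)
    fix P :: "nat \<Rightarrow> _" assume "range P \<subseteq> sets M" "disjoint_family P"
    then have "(\<lambda>i. measure m (P i)) sums measure m (\<Union>i. P i)" by (rule vector_measureD[OF m])
    then have "(\<Sum>i. ennreal (measure m (P i))) = ennreal (measure m (\<Union>i. P i))"
      by (intro suminf_ennreal_eq) auto
    then show "(\<Sum>i. ennreal (norm (measure m (P i)))) \<le> ennreal (measure m (\<Union>i. P i))"
      by simp
  qed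
qed

lemma pos_part_measure_finite_measure:
  assumes "finite_measure m" "sets m = sets M"
  shows "pos_part_measure M (measure m) = m"
proof (rule measure_eqI)
  fix E assume "E \<in> sets (pos_part_measure M (measure m))"
  then have E: "E \<in> sets M" by simp
  then show "emeasure (pos_part_measure M (measure m)) E = emeasure m E"
    using assms
    by (simp add: emeasure_pos_part_measure vector_measure_finite_measure
        total_variation_finite_measure finite_measure.emeasure_eq_measure)
qed (use assms in simp)

lemma pos_part_measure_uminus_finite_measure:
  assumes "finite_measure m" "sets m = sets M"
  shows "pos_part_measure M (\<lambda>E. - measure m E) = null_measure M"
proof (rule measure_eqI)
  fix E assume "E \<in> sets (pos_part_measure M (\<lambda>E. - measure m E))"
  then have E: "E \<in> sets M" by simp
  then show "emeasure (pos_part_measure M (\<lambda>E. - measure m E)) E = emeasure (null_measure M) E"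
    using assms
    by (simp add: emeasure_pos_part_measure vector_measure_finite_measure vector_measure_uminus
        total_variation_finite_measure total_variation_uminus)
qed simp

lemma real_measure_integral_finite_measure:
  assumes "finite_measure m" "sets m = sets M"
  shows "real_measure_integral M (measure m) f = integral\<^sup>L m f"
  using assms
  by (simp add: real_measure_integral_def pos_part_measure_finite_measure
      pos_part_measure_uminus_finite_measure integral_null_measure)

lemma real_measure_integral_zero: "real_measure_integral M (\<lambda>E. 0) f = 0"
proof -
  have "measure (null_measure M) = (\<lambda>E. 0)" by (auto simp: measure_def)
  then show ?thesis
    using real_measure_integral_finite_measure[of "null_measure M" M f]
    by (simp add: integral_null_measure finite_measureI)
qed

lemma complex_measure_integral_zero: "complex_measure_integral M (\<lambda>E. 0) f = 0"
  by (simp add: complex_measure_integral_def real_measure_integral_zero)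

section \<open>Point masses and translation\<close>

lemma dirac_eq_measure_return:
  "dirac z E = complex_of_real (measure (return circle_borel z) E)"
  by (cases "E \<in> sets circle_borel") (simp_all add: dirac_def measure_return measure_notin_sets)

lemma finite_measure_return: "z \<in> space M \<Longrightarrow> finite_measure (return M z)"
  by (intro prob_space.finite_measure prob_space_return)

lemma complex_measure_integral_dirac:
  assumes "z \<in> circle" "f \<in> borel_measurable circle_borel"
  shows "complex_measure_integral circle_borel (dirac z) f = f z"
proof -
  have "finite_measure (return circle_borel z)" using assms by (intro finite_measure_return) simp
  then have "real_measure_integral circle_borel (\<lambda>E. measure (return circle_borel z) E) f = f z"
    using assms by (simp add: real_measure_integral_finite_measure integral_return)
  then show ?thesis
    by (simp add: complex_measure_integral_def dirac_eq_measure_return[abs_def] real_measure_integral_zero)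
qed

lemma complex_measure_dirac:
  assumes "z \<in> circle"
  shows "complex_measure circle_borel (dirac z)"
proof -
  have "vector_measure circle_borel (measure (return circle_borel z))"
    using assms by (intro vector_measure_finite_measure finite_measure_return) auto
  then have "vector_measure circle_borel (dirac z)"
    unfolding vector_measure_def dirac_eq_measure_return[abs_def] by (auto intro!: sums_of_real)
  then show ?thesis by (simp add: complex_measure_iff dirac_def)
qed

lemma convolution_dirac:
  assumes "vector_measure circle_borel \<mu>" "w \<in> circle" "E \<in> sets circle_borel"
  shows "convolution \<mu> (dirac w) E = \<mu> (translate E w)"
  using complex_measure_integral_dirac[OF assms(2) borel_measurable_translate[OF assms(1,3)]] assms(3)
  by (simp add: convolution_def)

lemma convolution_dirac_dirac:
  assumes "z \<in> circle" "w \<in> circle"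
  shows "convolution (dirac z) (dirac w) = dirac (z * w)"
proof
  fix E show "convolution (dirac z) (dirac w) E = dirac (z * w) E"
  proof (cases "E \<in> sets circle_borel")
    case True
    then have "convolution (dirac z) (dirac w) E = dirac z (translate E w)"
      using assms complex_measure_dirac[OF assms(1)]
      by (intro convolution_dirac) (auto simp: complex_measure_iff)
    also have "\<dots> = dirac (z * w) E"
      using sets_translate[OF True assms(2)] True assms(1) by (simp add: dirac_def)
    finally show ?thesis .
  qed (simp add: convolution_def dirac_def)
qed

text \<open>Convolution with \<open>dirac w\<close> is translation by \<open>w\<close>, so it is
  undone by testing it on the set translated by \<open>inverse w\<close>. Applied to an element
  \<open>e\<close> of \<open>Exp\<close>, this identifies the quotient of two point masses in the
  same coset.\<close>

lemma convolution_dirac_cancel: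
  assumes \<mu>: "complex_measure circle_borel \<mu>" and z: "z \<in> circle" and w: "w \<in> circle"
    and eq: "convolution \<mu> (dirac w) = dirac z"
  shows "\<mu> = dirac (z / w)"
proof
  fix E show "\<mu> E = dirac (z / w) E"
  proof (cases "E \<in> sets circle_borel")
    case True
    have w': "inverse w \<in> circle" and w0: "w \<noteq> 0" using w by (auto simp: norm_inverse)
    define F where "F = translate E (inverse w)"
    have F: "F \<in> sets circle_borel" unfolding F_def by (rule sets_translate[OF True w'])
    have "translate F w = E"
      using True w w0 by (auto simp: F_def sets_circle_borel norm_mult mult.assoc)
    then have "\<mu> E = convolution \<mu> (dirac w) F"
      using \<mu> w F by (simp add: convolution_dirac complex_measure_iff)
    also have "\<dots> = dirac (z / w) E"
      unfolding eq using F True z by (simp add: dirac_def F_def divide_inverse)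
    finally show ?thesis .
  qed (use \<mu> in \<open>simp add: complex_measure_iff dirac_def\<close>)
qed

section \<open>Sums and powers in the measure algebra\<close>

lemma circle_measure_algebra_simps [simp]:
  "mult circle_measure_algebra = convolution"
  "one circle_measure_algebra = dirac 1"
  "zero circle_measure_algebra = (\<lambda>E. 0)"
  "add circle_measure_algebra = (\<lambda>\<mu> \<nu> E. \<mu> E + \<nu> E)"
  "smult circle_measure_algebra = (\<lambda>c \<mu> E. c * \<mu> E)"
  "alg_norm circle_measure_algebra = (\<lambda>\<mu>. enn2real (total_variation circle_borel \<mu> circle))"
  by (simp_all add: circle_measure_algebra_def)

lemma complex_measure_add:
  "complex_measure M \<mu> \<Longrightarrow> complex_measure M \<nu> \<Longrightarrow> complex_measure M (\<lambda>E. \<mu> E + \<nu> E)"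
  by (simp add: complex_measure_def sums_add)

lemma complex_measure_mult:
  "complex_measure M \<mu> \<Longrightarrow> complex_measure M (\<lambda>E. c * \<mu> E)"
  by (simp add: complex_measure_def sums_mult)

lemma complex_measure_zero: "complex_measure M (\<lambda>E. 0)"
  by (simp add: complex_measure_def)

text \<open>Gives access to the rules for \<open>finsum\<close> and additive inverses, which turn
  the partial sums in \<open>has_exp\<close> into pointwise sums of set functions.\<close>

lemma abelian_group_circle_measure_algebra: "abelian_group circle_measure_algebra"
proof (rule abelian_groupI)
  fix \<mu> assume "\<mu> \<in> carrier circle_measure_algebra"
  then show "\<exists>\<nu>\<in>carrier circle_measure_algebra. \<nu> \<oplus>\<^bsub>circle_measure_algebra\<^esub> \<mu> = \<zero>\<^bsub>circle_measure_algebra\<^esub>"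
    using complex_measure_mult[of circle_borel \<mu> "-1"]
    by (intro bexI[of _ "\<lambda>E. - \<mu> E"]) (auto simp: carrier_circle_measure_algebra)
qed (auto simp: carrier_circle_measure_algebra complex_measure_add complex_measure_zero algebra_simps)

interpretation CMA: abelian_group circle_measure_algebra
  by (rule abelian_group_circle_measure_algebra)

lemma minus_circle_measure_algebra:
  assumes "complex_measure circle_borel \<mu>" "complex_measure circle_borel \<nu>"
  shows "\<mu> \<ominus>\<^bsub>circle_measure_algebra\<^esub> \<nu> = (\<lambda>E. \<mu> E - \<nu> E)"
proof -
  have "(\<lambda>E. - \<nu> E) \<in> carrier circle_measure_algebra"
    using complex_measure_mult[OF assms(2), of "-1"] by (simp add: carrier_circle_measure_algebra)
  then have "\<ominus>\<^bsub>circle_measure_algebra\<^esub> \<nu> = (\<lambda>E. - \<nu> E)"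
    using assms by (intro CMA.minus_equality) (auto simp: carrier_circle_measure_algebra)
  then show ?thesis by (simp add: a_minus_def)
qed

lemma finsum_circle_measure_algebra:
  assumes "\<And>k. complex_measure circle_borel (f k)"
  shows "(\<Oplus>\<^bsub>circle_measure_algebra\<^esub>k\<in>{..<n::nat}. f k) = (\<lambda>E. \<Sum>k<n. f k E)"
proof (induction n)
  case (Suc n)
  have "f \<in> {..<n} \<rightarrow> carrier circle_measure_algebra" "f n \<in> carrier circle_measure_algebra"
    using assms by (auto simp: carrier_circle_measure_algebra)
  then have "(\<Oplus>\<^bsub>circle_measure_algebra\<^esub>k\<in>insert n {..<n}. f k)
      = f n \<oplus>\<^bsub>circle_measure_algebra\<^esub> (\<Oplus>\<^bsub>circle_measure_algebra\<^esub>k\<in>{..<n}. f k)"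
    by (intro CMA.finsum_insert) auto
  then show ?case using Suc by (simp add: lessThan_Suc add.commute)
qed simp

lemma complex_measure_sum:
  "(\<And>k. complex_measure M (f k)) \<Longrightarrow> complex_measure M (\<lambda>E. \<Sum>k<(n::nat). f k E)"
  by (induction n) (simp_all add: complex_measure_zero complex_measure_add)

lemma pow_circle_measure_algebra_simps:
  "\<mu> [^]\<^bsub>circle_measure_algebra\<^esub> (0::nat) = dirac 1"
  "\<mu> [^]\<^bsub>circle_measure_algebra\<^esub> Suc k = convolution (\<mu> [^]\<^bsub>circle_measure_algebra\<^esub> k) \<mu>"
  by (simp_all add: nat_pow_def)

lemma complex_measure_pow:
  "complex_measure circle_borel \<mu> \<Longrightarrow>
    complex_measure circle_borel (\<mu> [^]\<^bsub>circle_measure_algebra\<^esub> (k::nat))"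
proof (induction k)
  case 0
  then show ?case by (simp add: pow_circle_measure_algebra_simps complex_measure_dirac)
next
  case (Suc k)
  then show ?case
    unfolding pow_circle_measure_algebra_simps
    by (intro complex_measure_convolution) (simp_all add: complex_measure_iff)
qed

subsection \<open>Fourier coefficients of the discrete part\<close>

lemma has_sum_sum:
  fixes f :: "'i \<Rightarrow> 'a \<Rightarrow> 'b::topological_comm_monoid_add"
  assumes "\<And>i. i \<in> I \<Longrightarrow> (f i has_sum s i) A"
  shows "((\<lambda>x. \<Sum>i\<in>I. f i x) has_sum (\<Sum>i\<in>I. s i)) A"
  using assms by (induction I rule: infinite_finite_induct) (auto intro: has_sum_add)

text \<open>An atom has norm at most its variation, and the variation measure is additive over the
  finitely many singletons of \<open>F\<close>.\<close>

lemma sum_norm_atoms_le: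
  fixes \<mu> :: "'a set \<Rightarrow> 'b::euclidean_space"
  assumes \<mu>: "vector_measure M \<mu>" and F: "finite F" "F \<subseteq> space M"
    and sing: "\<And>x. x \<in> space M \<Longrightarrow> {x} \<in> sets M"
  shows "(\<Sum>x\<in>F. norm (\<mu> {x})) \<le> enn2real (total_variation M \<mu> (space M))"
proof -
  interpret V: finite_measure "variation_measure M \<mu>" by (rule finite_variation_measure[OF \<mu>])
  have "norm (\<mu> {x}) \<le> measure (variation_measure M \<mu>) {x}" if "x \<in> F" for x
  proof -
    have "{x} \<in> sets M" using that F sing by blast
    then show ?thesis
      using total_variation_norm_le[OF \<mu>, of "{x}"]
      by (simp add: V.emeasure_eq_measure flip: emeasure_variation_measure[OF \<mu>])
  qed
  then have "(\<Sum>x\<in>F. norm (\<mu> {x})) \<le> (\<Sum>x\<in>F. measure (variation_measure M \<mu>) {x})"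
    by (rule sum_mono)
  also have "\<dots> = measure (variation_measure M \<mu>) F"
    using F sing by (intro V.finite_measure_eq_sum_singleton[symmetric]) auto
  also have "\<dots> \<le> measure (variation_measure M \<mu>) (space M)"
    using V.bounded_measure by simp
  also have "\<dots> = enn2real (total_variation M \<mu> (space M))"
    by (simp add: measure_def emeasure_variation_measure[OF \<mu>])
  finally show ?thesis .
qed

lemma sets_circle_singleton: "x \<in> circle \<Longrightarrow> {x} \<in> sets circle_borel"
  by (simp add: sets_circle_borel)

lemma summable_norm_atoms:
  fixes \<mu> :: "complex set \<Rightarrow> complex"
  assumes "vector_measure circle_borel \<mu>"
  shows "(\<lambda>x. norm (\<mu> {x})) summable_on circle"
    and "(\<Sum>\<^sub>\<infinity>x\<in>circle. norm (\<mu> {x})) \<le> enn2real (total_variation circle_borel \<mu> circle)"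
proof -
  have le: "(\<Sum>x\<in>F. norm (\<mu> {x})) \<le> enn2real (total_variation circle_borel \<mu> circle)"
    if "finite F" "F \<subseteq> circle" for F
    using sum_norm_atoms_le[OF assms that(1)] that(2) sets_circle_singleton by simp
  then show "(\<lambda>x. norm (\<mu> {x})) summable_on circle"
    by (intro nonneg_bdd_above_summable_on bdd_aboveI2) auto
  then show "(\<Sum>\<^sub>\<infinity>x\<in>circle. norm (\<mu> {x})) \<le> enn2real (total_variation circle_borel \<mu> circle)"
    using le by (rule infsum_le_finite_sums)
qed

text \<open>On the countable set \<open>C\<close> the measure is counting measure weighted by the
  point masses, so the integral is a sum over \<open>C\<close>. A continuous part of
  \<open>m\<close> does not contribute, since countable sets carry none of it.\<close>

lemma has_sum_integral_countable_support:
  fixes g :: "'a \<Rightarrow> 'b::{banach, second_countable_topology}"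
  assumes m: "finite_measure m" and C: "countable C" "C \<subseteq> space m" "\<And>x. x \<in> C \<Longrightarrow> {x} \<in> sets m"
    and supp: "\<And>x. x \<in> space m - C \<Longrightarrow> g x = 0" and bound: "\<And>x. x \<in> C \<Longrightarrow> norm (g x) \<le> B"
  shows "((\<lambda>x. measure m {x} *\<^sub>R g x) has_sum integral\<^sup>L m g) C"
proof -
  interpret finite_measure m by (rule m)
  have Cm: "C \<in> sets m" by (rule sets.countable[OF C(3,1)])
  have "(\<lambda>x. norm (measure m {x} *\<^sub>R g x)) summable_on C"
  proof (rule nonneg_bdd_above_summable_on)
    show "bdd_above (sum (\<lambda>x. norm (measure m {x} *\<^sub>R g x)) ` {F. F \<subseteq> C \<and> finite F})"
    proof (rule bdd_aboveI2)
      fix F assume "F \<in> {F. F \<subseteq> C \<and> finite F}"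
      then have F: "F \<subseteq> C" "finite F" by auto
      \<comment> \<open>The absolute value keeps the factor nonnegative: \<open>B\<close> may be
        negative when \<open>C\<close> is empty.\<close>
      have "(\<Sum>x\<in>F. norm (measure m {x} *\<^sub>R g x)) \<le> (\<Sum>x\<in>F. measure m {x} * \<bar>B\<bar>)"
      proof (rule sum_mono)
        fix x assume "x \<in> F"
        then have "norm (g x) \<le> \<bar>B\<bar>" using F(1) bound[of x] by auto
        then show "norm (measure m {x} *\<^sub>R g x) \<le> measure m {x} * \<bar>B\<bar>"
          by (simp add: mult_left_mono)
      qed
      also have "\<dots> = measure m F * \<bar>B\<bar>"
        using F C(3) by (subst finite_measure_eq_sum_singleton) (simp_all add: sum_distrib_right subset_iff)
      also have "\<dots> \<le> measure m (space m) * \<bar>B\<bar>"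
        by (rule mult_right_mono[OF bounded_measure abs_ge_zero])
      finally show "(\<Sum>x\<in>F. norm (measure m {x} *\<^sub>R g x)) \<le> measure m (space m) * \<bar>B\<bar>" .
    qed
  qed (rule norm_ge_zero)
  then have abs: "Infinite_Set_Sum.abs_summable_on (\<lambda>x. measure m {x} *\<^sub>R g x) C"
    and sm: "(\<lambda>x. measure m {x} *\<^sub>R g x) summable_on C"
    by (rule abs_summable_equivalent[THEN iffD1], rule abs_summable_summable)
  have sing: "{x} \<in> sets (restrict_space m C)" if "x \<in> C" for x
    using that C(2,3) Cm by (subst sets_restrict_space_iff) (simp_all add: sets.Int)
  \<comment> \<open>Two measures on a countable space agree as soon as they agree on
    singletons.\<close>
  have restr: "restrict_space m C = density (count_space C) (\<lambda>x. ennreal (measure m {x}))"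
  proof (rule measure_eqI_countable')
    fix x assume x: "x \<in> C"
    then show "emeasure (restrict_space m C) {x} = emeasure (density (count_space C) (\<lambda>x. ennreal (measure m {x}))) {x}"
      using C(2,3) Cm by (simp add: emeasure_restrict_space emeasure_density emeasure_eq_measure nn_integral_indicator_singleton)
  next
    show "space (restrict_space m C) = C" using C(2) by (auto simp: space_restrict_space)
  qed (use C(1) sing in simp_all)
  have "integral\<^sup>L m g = integral\<^sup>L m (\<lambda>x. indicator C x *\<^sub>R g x)"
    using supp by (intro Bochner_Integration.integral_cong) (auto simp: indicator_def)
  also have "\<dots> = integral\<^sup>L (restrict_space m C) g"
    by (rule integral_restrict_space[OF sets.Int[OF Cm sets.top], symmetric])
  also have "\<dots> = infsetsum (\<lambda>x. measure m {x} *\<^sub>R g x) C"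
    unfolding restr infsetsum_def by (subst integral_density) auto
  also have "\<dots> = infsum (\<lambda>x. measure m {x} *\<^sub>R g x) C"
    by (rule infsetsum_infsum[OF abs])
  finally have eq: "integral\<^sup>L m g = infsum (\<lambda>x. measure m {x} *\<^sub>R g x) C" .
  show ?thesis unfolding eq by (rule has_sum_infsum[OF sm])
qed

section \<open>Atoms of a convolution\<close>

lemma translate_singleton:
  assumes "x \<in> circle" "y \<in> circle"
  shows "translate {x} y = {x / y}"
proof -
  have "y \<noteq> 0" using assms(2) by auto
  then have "w * y = x \<longleftrightarrow> w = x / y" for w by (simp add: eq_divide_eq)
  then show ?thesis using assms by (auto simp: norm_divide)
qed

lemma bij_betw_circle_divide:
  assumes "y \<in> circle"
  shows "bij_betw (\<lambda>x. x / y) circle circle"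
  by (rule bij_betw_byWitness[where f' = "\<lambda>x. x * y"])
    (use assms in \<open>auto simp: norm_divide norm_mult\<close>)

text \<open>The integrand sends \<open>y\<close> to \<open>\<mu> {x / y}\<close>, which is nonzero
  for only countably many \<open>y\<close>. Its integral against \<open>\<nu>\<close> is therefore a
  sum over atoms, so the discrete part of a convolution depends only on the discrete parts of the
  factors.\<close>

lemma convolution_atom:
  assumes \<mu>: "vector_measure circle_borel \<mu>" and \<nu>: "vector_measure circle_borel \<nu>" and x: "x \<in> circle"
  shows "convolution \<mu> \<nu> {x} = (\<Sum>\<^sub>\<infinity>y\<in>circle. \<nu> {y} * \<mu> {x / y})"
proof -
  define C where "C = {y \<in> circle. \<mu> {x / y} \<noteq> 0}"
  let ?n = "jordan circle_borel \<nu>"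
  have "countable {w \<in> circle. \<mu> {w} \<noteq> 0}"
    using abs_summable_countable[OF summable_norm_atoms(1)[OF \<mu>]] .
  \<comment> \<open>The map sending \<open>w\<close> to \<open>x / w\<close> is its own inverse and
    carries the countable set of atoms of \<open>\<mu>\<close> onto \<open>C\<close>.\<close>
  moreover have "C \<subseteq> (\<lambda>w. x / w) ` {w \<in> circle. \<mu> {w} \<noteq> 0}"
  proof
    fix y assume y: "y \<in> C"
    then have "x \<noteq> 0" "x / y \<in> circle"
      using x by (auto simp: C_def norm_divide)
    then show "y \<in> (\<lambda>w. x / w) ` {w \<in> circle. \<mu> {w} \<noteq> 0}"
      using y by (intro image_eqI[of _ _ "x / y"]) (simp_all add: C_def)
  qed
  ultimately have C: "countable C" by (meson countable_image countable_subset)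
  have "((\<lambda>y. measure (?n k) {y} *\<^sub>R \<mu> {x / y}) has_sum (\<integral>y. \<mu> {x / y} \<partial>?n k)) C" for k
  proof (rule has_sum_integral_countable_support[OF finite_jordan[OF \<nu>] C])
    fix y assume "y \<in> C"
    then have "x / y \<in> circle" using x by (simp add: C_def norm_divide)
    then show "norm (\<mu> {x / y}) \<le> enn2real (total_variation circle_borel \<mu> circle)"
      using sum_norm_atoms_le[OF \<mu>, of "{x / y}"] sets_circle_singleton by simp
  qed (auto simp: C_def sets_circle_singleton)
  then have "((\<lambda>y. \<i> ^ k * (measure (?n k) {y} *\<^sub>R \<mu> {x / y})) has_sum \<i> ^ k * (\<integral>y. \<mu> {x / y} \<partial>?n k)) C" for k
    by (rule has_sum_cmult_right)
  then have "((\<lambda>y. \<Sum>k<4. \<i> ^ k * (measure (?n k) {y} *\<^sub>R \<mu> {x / y})) has_sum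
      (\<Sum>k<4. \<i> ^ k * (\<integral>y. \<mu> {x / y} \<partial>?n k))) C"
    by (intro has_sum_sum)
  \<comment> \<open>Outside \<open>C\<close> the terms vanish, so the sum extends to the whole
    circle; the four Jordan weights of \<open>{y}\<close> recombine to
    \<open>\<nu> {y}\<close>.\<close>
  also have "?this \<longleftrightarrow> ((\<lambda>y. \<nu> {y} * \<mu> {x / y}) has_sum
      (\<Sum>k<4. \<i> ^ k * (\<integral>y. \<mu> {x / y} \<partial>?n k))) circle"
    using jordan_sum[OF \<nu> sets_circle_singleton]
    by (intro has_sum_cong_neutral) (auto simp: C_def sum_distrib_right scaleR_conv_of_real mult.assoc)
  also have "(\<Sum>k<4. \<i> ^ k * (\<integral>y. \<mu> {x / y} \<partial>?n k)) = complex_measure_integral circle_borel \<nu> (\<lambda>y. \<mu> (translate {x} y))"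
    unfolding complex_measure_integral_jordan
    by (intro sum.cong refl arg_cong2[where f = "(*)"] Bochner_Integration.integral_cong)
      (subst translate_singleton[OF x], simp_all)
  also have "\<dots> = convolution \<mu> \<nu> {x}"
    using sets_circle_singleton[OF x] by (simp add: convolution_def)
  finally show ?thesis by (simp add: infsumI)
qed

section \<open>The functionals \<open>\<Phi>\<^sub>n\<close>\<close>

definition atomic_transform :: "nat \<Rightarrow> (complex set \<Rightarrow> complex) \<Rightarrow> complex" where
  "atomic_transform n \<mu> = (\<Sum>\<^sub>\<infinity>x\<in>circle. \<mu> {x} * x ^ n)"

lemma summable_atomic_transform:
  assumes "vector_measure circle_borel \<mu>"
  shows "(\<lambda>x. norm (\<mu> {x} * x ^ n)) summable_on circle" "(\<lambda>x. \<mu> {x} * x ^ n) summable_on circle"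
proof -
  have "(\<lambda>x. norm (\<mu> {x})) summable_on circle \<longleftrightarrow> (\<lambda>x. norm (\<mu> {x} * x ^ n)) summable_on circle"
    by (rule summable_on_cong) (simp add: norm_mult norm_power)
  then show 1: "(\<lambda>x. norm (\<mu> {x} * x ^ n)) summable_on circle"
    using summable_norm_atoms(1)[OF assms] by blast
  then show "(\<lambda>x. \<mu> {x} * x ^ n) summable_on circle" by (rule abs_summable_summable)
qed

text \<open>Powers of points of the circle have modulus 1, so only the total weight of the atoms
  matters, and this is bounded by the variation.\<close>

lemma norm_atomic_transform_le:
  assumes "vector_measure circle_borel \<mu>"
  shows "norm (atomic_transform n \<mu>) \<le> enn2real (total_variation circle_borel \<mu> circle)"
proof -
  have "norm (atomic_transform n \<mu>) \<le> (\<Sum>\<^sub>\<infinity>x\<in>circle. norm (\<mu> {x} * x ^ n))"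
    unfolding atomic_transform_def by (rule norm_infsum_bound[OF summable_atomic_transform(1)[OF assms]])
  also have "\<dots> = (\<Sum>\<^sub>\<infinity>x\<in>circle. norm (\<mu> {x}))"
    by (rule infsum_cong) (simp add: norm_mult norm_power)
  finally show ?thesis using summable_norm_atoms(2)[OF assms] by linarith
qed

lemma atomic_transform_diff:
  assumes "vector_measure circle_borel \<mu>" "vector_measure circle_borel \<nu>"
  shows "atomic_transform n (\<lambda>E. \<mu> E - \<nu> E) = atomic_transform n \<mu> - atomic_transform n \<nu>"
proof -
  have "((\<lambda>x. \<mu> {x} * x ^ n + (-1) * (\<nu> {x} * x ^ n)) has_sum
      atomic_transform n \<mu> + (-1) * atomic_transform n \<nu>) circle"
    unfolding atomic_transform_def
    by (intro has_sum_add has_sum_cmult_right has_sum_infsum summable_atomic_transform assms)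
  then show ?thesis
    unfolding atomic_transform_def[of n "\<lambda>E. _ E - _ E"] by (simp add: infsumI left_diff_distrib)
qed

lemma atomic_transform_sum:
  assumes "\<And>k. vector_measure circle_borel (f k)"
  shows "atomic_transform n (\<lambda>E. \<Sum>k<(N::nat). f k E) = (\<Sum>k<N. atomic_transform n (f k))"
  unfolding atomic_transform_def sum_distrib_right
  by (intro infsumI has_sum_sum has_sum_infsum summable_atomic_transform assms)

lemma atomic_transform_mult: "atomic_transform n (\<lambda>E. c * \<mu> E) = c * atomic_transform n \<mu>"
  unfolding atomic_transform_def mult.assoc by (rule infsum_cmult_right')

lemma atomic_transform_dirac:
  assumes "z \<in> circle"
  shows "atomic_transform n (dirac z) = z ^ n"
proof -
  have "atomic_transform n (dirac z) = (\<Sum>\<^sub>\<infinity>x\<in>{z}. z ^ n)"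
    unfolding atomic_transform_def using assms
    by (intro infsum_cong_neutral) (auto simp: dirac_def sets_circle_singleton)
  then show ?thesis by simp
qed

text \<open>By the formula for the atoms of a convolution the left side is a double sum. It is
  absolutely summable because division by \<open>y\<close> permutes the circle, so the order can be
  exchanged and the substitution of \<open>x / y\<close> for \<open>x\<close> separates the
  factors.\<close>

lemma atomic_transform_convolution:
  assumes \<mu>: "vector_measure circle_borel \<mu>" and \<nu>: "vector_measure circle_borel \<nu>"
  shows "atomic_transform n (convolution \<mu> \<nu>) = atomic_transform n \<mu> * atomic_transform n \<nu>"
proof -
  let ?f = "\<lambda>y x. \<nu> {y} * \<mu> {x / y} * x ^ n"
  let ?s = "\<Sum>\<^sub>\<infinity>x\<in>circle. norm (\<mu> {x})"
  have norm_f: "norm (?f y x) = norm (\<nu> {y}) * norm (\<mu> {x / y})" if "x \<in> circle" for x y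
    using that by (simp add: norm_mult norm_power)
  have sum_y: "(\<lambda>x. norm (?f y x)) summable_on circle" if y: "y \<in> circle" for y
  proof -
    have "(\<lambda>x. norm (\<mu> {x / y})) summable_on circle"
      using summable_on_reindex_bij_betw[OF bij_betw_circle_divide[OF y], of "\<lambda>w. norm (\<mu> {w})"]
        summable_norm_atoms(1)[OF \<mu>] by simp
    then have "(\<lambda>x. norm (\<nu> {y}) * norm (\<mu> {x / y})) summable_on circle"
      by (rule summable_on_cmult_right)
    then show ?thesis
      using summable_on_cong[of circle "\<lambda>x. norm (?f y x)" "\<lambda>x. norm (\<nu> {y}) * norm (\<mu> {x / y})"] norm_f
      by blast
  qed
  have inf_y: "(\<Sum>\<^sub>\<infinity>x\<in>circle. norm (?f y x)) = norm (\<nu> {y}) * ?s" if y: "y \<in> circle" for y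
  proof -
    have "(\<Sum>\<^sub>\<infinity>x\<in>circle. norm (?f y x)) = (\<Sum>\<^sub>\<infinity>x\<in>circle. norm (\<nu> {y}) * norm (\<mu> {x / y}))"
      by (rule infsum_cong) (rule norm_f)
    also have "\<dots> = norm (\<nu> {y}) * (\<Sum>\<^sub>\<infinity>x\<in>circle. norm (\<mu> {x / y}))"
      by (rule infsum_cmult_right')
    also have "(\<Sum>\<^sub>\<infinity>x\<in>circle. norm (\<mu> {x / y})) = ?s"
      using infsum_reindex_bij_betw[OF bij_betw_circle_divide[OF y], of "\<lambda>w. norm (\<mu> {w})"] .
    finally show ?thesis .
  qed
  \<comment> \<open>Absolute summability over the product: the inner sums of norms equal
    \<open>norm (\<nu> {y}) * ?s\<close>, which is summable in \<open>y\<close>.\<close>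
  have "(\<lambda>y. norm (\<nu> {y}) * ?s) summable_on circle"
    by (rule summable_on_cmult_left[OF summable_norm_atoms(1)[OF \<nu>]])
  moreover have "(\<lambda>y. norm (\<Sum>\<^sub>\<infinity>x\<in>circle. norm (?f y x))) summable_on circle
      \<longleftrightarrow> (\<lambda>y. norm (\<nu> {y}) * ?s) summable_on circle"
    by (rule summable_on_cong) (subst inf_y, simp_all add: abs_mult infsum_nonneg)
  ultimately have "(\<lambda>p. norm ((\<lambda>(y, x). ?f y x) p)) summable_on circle \<times> circle"
    using sum_y by (subst Infinite_Sum.abs_summable_on_Sigma_iff) simp
  then have sm: "(\<lambda>(y, x). ?f y x) summable_on circle \<times> circle"
    by (rule abs_summable_summable)
  have "atomic_transform n (convolution \<mu> \<nu>) = (\<Sum>\<^sub>\<infinity>x\<in>circle. \<Sum>\<^sub>\<infinity>y\<in>circle. ?f y x)"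
    unfolding atomic_transform_def
    by (intro infsum_cong) (simp only: convolution_atom[OF \<mu> \<nu>] infsum_cmult_left')
  also have "\<dots> = (\<Sum>\<^sub>\<infinity>y\<in>circle. \<Sum>\<^sub>\<infinity>x\<in>circle. ?f y x)"
    by (rule infsum_swap_banach[OF sm, symmetric])
  also have "\<dots> = (\<Sum>\<^sub>\<infinity>y\<in>circle. \<nu> {y} * y ^ n * atomic_transform n \<mu>)"
  proof (rule infsum_cong)
    fix y assume y: "y \<in> circle"
    \<comment> \<open>The character splits as \<open>x ^ n = y ^ n * (x / y) ^ n\<close>, and
      \<open>x / y\<close> runs over the circle exactly once as \<open>x\<close> does.\<close>
    then have "y \<noteq> 0" by auto
    then have "(\<Sum>\<^sub>\<infinity>x\<in>circle. ?f y x) = (\<Sum>\<^sub>\<infinity>x\<in>circle. (\<nu> {y} * y ^ n) * (\<mu> {x / y} * (x / y) ^ n))"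
      by (intro infsum_cong) (simp add: power_divide)
    also have "\<dots> = (\<nu> {y} * y ^ n) * (\<Sum>\<^sub>\<infinity>x\<in>circle. \<mu> {x / y} * (x / y) ^ n)"
      by (rule infsum_cmult_right')
    also have "(\<Sum>\<^sub>\<infinity>x\<in>circle. \<mu> {x / y} * (x / y) ^ n) = atomic_transform n \<mu>"
      unfolding atomic_transform_def
      using infsum_reindex_bij_betw[OF bij_betw_circle_divide[OF y], of "\<lambda>w. \<mu> {w} * w ^ n"] .
    finally show "(\<Sum>\<^sub>\<infinity>x\<in>circle. ?f y x) = \<nu> {y} * y ^ n * atomic_transform n \<mu>" .
  qed
  also have "\<dots> = atomic_transform n \<nu> * atomic_transform n \<mu>"
    unfolding atomic_transform_def by (rule infsum_cmult_left')
  finally show ?thesis by (simp add: mult.commute)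
qed

subsection \<open>Point masses that are exponentials\<close>

lemma atomic_transform_pow:
  assumes "complex_measure circle_borel \<mu>"
  shows "atomic_transform n (\<mu> [^]\<^bsub>circle_measure_algebra\<^esub> k) = atomic_transform n \<mu> ^ k"
proof (induction k)
  case 0
  show ?case by (simp add: pow_circle_measure_algebra_simps atomic_transform_dirac)
next
  case (Suc k)
  then show ?case
    using assms complex_measure_pow[OF assms, of k]
    by (simp add: pow_circle_measure_algebra_simps atomic_transform_convolution complex_measure_iff)
qed

text \<open>The functional is linear, multiplicative and bounded by the norm, so it carries the
  norm-convergent exponential series of \<open>a\<close> to the scalar exponential series.\<close>

lemma atomic_transform_has_exp:
  assumes a: "complex_measure circle_borel a" and b: "complex_measure circle_borel b"
    and exp: "has_exp circle_measure_algebra a b"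
  shows "atomic_transform n b = exp (atomic_transform n a)"
proof -
  define c :: "nat \<Rightarrow> complex set \<Rightarrow> complex"
    where "c k = (\<lambda>E. (1 / fact k) * (a [^]\<^bsub>circle_measure_algebra\<^esub> k) E)" for k
  have c: "complex_measure circle_borel (c k)" for k
    unfolding c_def by (intro complex_measure_mult complex_measure_pow a)
  define s where "s N = (\<lambda>E. \<Sum>k<N. c k E)" for N :: nat
  have s: "complex_measure circle_borel (s N)" for N
    unfolding s_def by (intro complex_measure_sum c)
  have diff: "complex_measure circle_borel (\<lambda>E. b E - s N E)" for N
    using complex_measure_add[OF b complex_measure_mult[OF s, of "-1" N]] by simp
  \<comment> \<open>This is \<open>has_exp\<close> with the algebra operations replaced by pointwise
    ones.\<close>
  have lim: "(\<lambda>N. enn2real (total_variation circle_borel (\<lambda>E. b E - s N E) circle)) \<longlonglongrightarrow> 0"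
    using exp minus_circle_measure_algebra[OF b s] finsum_circle_measure_algebra[of c, OF c]
    by (simp add: has_exp_def s_def c_def)
  have le: "norm (atomic_transform n b - (\<Sum>k<N. atomic_transform n (c k)))
      \<le> enn2real (total_variation circle_borel (\<lambda>E. b E - s N E) circle)" for N
  proof -
    have "atomic_transform n (\<lambda>E. b E - s N E) = atomic_transform n b - atomic_transform n (s N)"
      using b s by (intro atomic_transform_diff) (auto simp: complex_measure_iff)
    also have "atomic_transform n (s N) = (\<Sum>k<N. atomic_transform n (c k))"
      unfolding s_def using c by (intro atomic_transform_sum) (auto simp: complex_measure_iff)
    finally show ?thesis
      using norm_atomic_transform_le[of "\<lambda>E. b E - s N E" n] diff[of N] by (simp add: complex_measure_iff)
  qed
  have "(\<lambda>N. atomic_transform n b - (\<Sum>k<N. atomic_transform n (c k))) \<longlonglongrightarrow> 0"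
    by (rule Lim_null_comparison[OF always_eventually lim]) (rule allI[OF le])
  from tendsto_diff[OF tendsto_const[of "atomic_transform n b"] this]
  have "(\<lambda>N. \<Sum>k<N. atomic_transform n (c k)) \<longlonglongrightarrow> atomic_transform n b"
    by simp
  moreover have "atomic_transform n (c k) = atomic_transform n a ^ k /\<^sub>R fact k" for k
    unfolding c_def atomic_transform_mult atomic_transform_pow[OF a]
    by (simp add: scaleR_conv_of_real divide_inverse)
  ultimately have "(\<lambda>k. atomic_transform n a ^ k /\<^sub>R fact k) sums atomic_transform n b"
    by (simp add: sums_def)
  then show ?thesis using exp_converges sums_unique2 by blast
qed

section \<open>Dirichlet approximation and logarithms near zero\<close>

lemma norm_cis_minus_1_le: "norm (cis t - 1) \<le> \<bar>t\<bar>"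
proof -
  have "norm (cis t - 1) = 2 * \<bar>sin (t / 2)\<bar>"
    using dist_exp_i_1[of t] by (simp add: cis_conv_exp dist_norm)
  then show ?thesis using abs_sin_x_le_abs_x[of "t / 2"] by simp
qed

text \<open>Dirichlet's theorem gives one multiplier \<open>q\<close> that brings all the numbers
  \<open>Arg x / (2 * pi)\<close> close to integers at once; then every \<open>x ^ q\<close> has an
  angle close to a multiple of \<open>2 * pi\<close>.\<close>

lemma simultaneous_power_close_to_1:
  assumes "finite F" "F \<subseteq> circle" "\<epsilon> > 0"
  obtains p where "p \<ge> 1" "\<And>x. x \<in> F \<Longrightarrow> norm (x ^ p - 1) < \<epsilon>"
proof -
  obtain h where h: "bij_betw h {0..<card F} F"
    using ex_bij_betw_nat_finite[OF assms(1)] by blast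
  \<comment> \<open>An error of \<open>1 / N\<close> in units of full turns is an angle of
    \<open>2 * pi / N\<close>, which must stay below \<open>\<epsilon>\<close>.\<close>
  define N where "N = Suc (nat \<lceil>2 * pi / \<epsilon>\<rceil>)"
  have "2 * pi / \<epsilon> < real N" unfolding N_def by linarith
  moreover have "N > 0" by (simp add: N_def)
  ultimately have N: "2 * pi / real N < \<epsilon>" using assms(3) by (simp add: field_simps)
  from \<open>N > 0\<close> obtain q r where q: "0 < q"
    and r: "\<And>i. i < card F \<Longrightarrow> \<bar>of_int q * (Arg (h i) / (2 * pi)) - of_int (r i)\<bar> < 1 / real N"
    using Dirichlet_approx_simult[of N "card F" "\<lambda>i. Arg (h i) / (2 * pi)"] by metis
  show ?thesis
  proof
    show "nat q \<ge> 1" using q by simp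
    fix x assume x: "x \<in> F"
    then obtain i where i: "i < card F" "x = h i" using h by (force simp: bij_betw_def)
    have "norm x = 1" using x assms(2) by auto
    moreover from this have "x \<noteq> 0" by auto
    ultimately have x_eq: "cis (Arg x) = x" by (simp add: cis_Arg sgn_div_norm)
    have "x ^ nat q = cis (Arg x) ^ nat q" by (simp only: x_eq)
    also have "\<dots> = cis (of_int q * Arg x)"
      using q by (simp add: Complex.DeMoivre)
    also have "\<dots> = cis (of_int q * Arg x - 2 * pi * of_int (r i))"
      by (simp add: cis_divide[symmetric] cis_multiple_2pi)
    finally have "norm (x ^ nat q - 1) \<le> \<bar>of_int q * Arg x - 2 * pi * of_int (r i)\<bar>"
      using norm_cis_minus_1_le by simp
    also have "\<dots> = 2 * pi * \<bar>of_int q * (Arg (h i) / (2 * pi)) - of_int (r i)\<bar>"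
    proof -
      have "of_int q * Arg x - 2 * pi * of_int (r i)
          = 2 * pi * (of_int q * (Arg (h i) / (2 * pi)) - of_int (r i))"
        unfolding i(2) by (simp add: field_simps)
      then show ?thesis by (simp add: abs_mult)
    qed
    also have "\<dots> \<le> 2 * pi * (1 / real N)"
      using r[OF i(1)] by (intro mult_left_mono) auto
    finally show "norm (x ^ nat q - 1) < \<epsilon>" using N by simp
  qed
qed

text \<open>Two logarithms of the same number differ by a multiple of \<open>2 * pi * \<i>\<close>,
  while two points of the open unit disc differ by less than 2.\<close>

lemma exp_inj_norm_less_1:
  assumes "exp x = exp (y::complex)" "norm x < 1" "norm y < 1"
  shows "x = y"
proof -
  have "exp (x - y) = 1" using assms(1) by (simp add: exp_diff)
  then obtain k :: int where k: "Re (x - y) = 0" "Im (x - y) = of_int (2 * k) * pi"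
    by (auto simp: exp_eq_1)
  have "\<bar>Im (x - y)\<bar> \<le> norm x + norm y"
    using abs_Im_le_cmod[of "x - y"] norm_triangle_ineq4[of x y] by linarith
  then have lt: "\<bar>real_of_int (2 * k)\<bar> * pi < 2" using k(2) assms by (simp add: abs_mult)
  have "k = 0"
  proof (rule ccontr)
    assume "k \<noteq> 0"
    then have "\<bar>real_of_int (2 * k)\<bar> * pi \<ge> 2 * pi" by (intro mult_right_mono) auto
    then show False using lt pi_gt3 by linarith
  qed
  then show ?thesis using k by (simp add: complex_eq_iff)
qed

text \<open>The numbers \<open>f n\<close> are bounded logarithms of \<open>z ^ n\<close>. An almost
  period \<open>p\<close> makes \<open>f\<close> drift by a constant \<open>c\<close> every
  \<open>p\<close> steps, and boundedness forces \<open>c = 0\<close>.\<close>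

lemma dirac_in_Exp_imp_torsion:
  assumes z: "z \<in> circle" and exp: "dirac z \<in> Exp circle_measure_algebra"
  obtains p where "p \<ge> 1" "z ^ p = 1"
proof -
  obtain a where a: "complex_measure circle_borel a" and he: "has_exp circle_measure_algebra a (dirac z)"
    using exp by (auto simp: Exp_def carrier_circle_measure_algebra)
  have av: "vector_measure circle_borel a" using a by (simp add: complex_measure_iff)
  define f where "f n = atomic_transform n a" for n
  have exp_f: "exp (f n) = z ^ n" for n
    using atomic_transform_has_exp[OF a complex_measure_dirac[OF z] he, of n]
    by (simp add: f_def atomic_transform_dirac[OF z])
  define w where "w x = norm (a {x})" for x
  have w: "w summable_on circle" "w x \<ge> 0" for x
    using summable_norm_atoms(1)[OF av] by (simp_all add: w_def[abs_def])
  define S where "S = infsum w circle"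
  have S0: "S \<ge> 0" unfolding S_def by (intro infsum_nonneg w)
  \<comment> \<open>The finite set \<open>F\<close> is to carry all but \<open>1 / 8\<close> of the
    atomic mass. As \<open>norm (x ^ p - 1)\<close> is at most 2, the atoms outside \<open>F\<close>
    then contribute less than \<open>1 / 4\<close> to \<open>f (n + p) - f n\<close>.\<close>
  have "(sum w \<longlongrightarrow> S) (finite_subsets_at_top circle)"
    using has_sum_infsum[OF w(1)] by (simp add: has_sum_def S_def)
  then have "\<forall>\<^sub>F F in finite_subsets_at_top circle. dist (sum w F) S < 1 / 8"
    by (rule tendstoD) simp
  then obtain F where F: "finite F" "F \<subseteq> circle" "dist (sum w F) S < 1 / 8"
    by (auto simp: eventually_finite_subsets_at_top)
  have smD: "w summable_on (circle - F)" using w(1) by (rule summable_on_subset_banach) auto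
  have tail_eq: "infsum w (circle - F) = S - sum w F"
    using infsum_Diff[OF w(1) summable_on_finite[OF F(1)] F(2)] F(1) by (simp add: S_def)
  then have tail: "infsum w (circle - F) < 1 / 8"
    using F(3) unfolding dist_real_def tail_eq by linarith
  have sumF: "sum w F \<le> S"
    unfolding S_def by (rule finite_sum_le_infsum) (use F w in auto)
  \<comment> \<open>The atoms in \<open>F\<close> contribute at most
    \<open>S / (4 * (S + 1))\<close>, hence at most \<open>1 / 4\<close>. Using \<open>S + 1\<close>
    keeps the tolerance meaningful when \<open>S = 0\<close>.\<close>
  obtain p where p: "p \<ge> 1" "\<And>x. x \<in> F \<Longrightarrow> norm (x ^ p - 1) < 1 / (4 * (S + 1))"
    using simultaneous_power_close_to_1[OF F(1,2), of "1 / (4 * (S + 1))"] S0 by auto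
  have close: "norm (f (n + p) - f n) < 1" for n
  proof -
    let ?g = "\<lambda>x. a {x} * x ^ (n + p) + (-1) * (a {x} * x ^ n)"
    have g: "(?g has_sum (f (n + p) + (-1) * f n)) circle"
      unfolding f_def atomic_transform_def
      by (intro has_sum_add has_sum_cmult_right has_sum_infsum summable_atomic_transform av)
    have norm_g: "norm (?g x) = w x * norm (x ^ p - 1)" if "x \<in> circle" for x
    proof -
      have "?g x = a {x} * x ^ n * (x ^ p - 1)" by (simp add: algebra_simps power_add)
      then show ?thesis using that by (simp add: norm_mult norm_power w_def)
    qed
    have "norm (x ^ p - 1) \<le> 2" if "x \<in> circle" for x
      using norm_triangle_ineq4[of "x ^ p" 1] that by (simp add: norm_power)
    then have bound2: "norm (?g x) \<le> 2 * w x" if "x \<in> circle" for x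
      using norm_g[OF that] mult_left_mono[OF _ w(2)] that by (metis mult.commute)
    have sm2: "(\<lambda>x. 2 * w x) summable_on circle" "(\<lambda>x. 2 * w x) summable_on (circle - F)"
      using w(1) smD by (auto intro: summable_on_cmult_right)
    have smg: "(\<lambda>x. norm (?g x)) summable_on circle"
      by (rule summable_on_comparison_test[OF sm2(1)]) (use bound2 in auto)
    have smgD: "(\<lambda>x. norm (?g x)) summable_on (circle - F)"
      using smg by (rule summable_on_subset_banach) auto
    have "norm (f (n + p) - f n) \<le> infsum (\<lambda>x. norm (?g x)) circle"
      using norm_infsum_bound[OF smg] infsumI[OF g] by simp
    also have "\<dots> = (\<Sum>x\<in>F. norm (?g x)) + infsum (\<lambda>x. norm (?g x)) (circle - F)"
      using infsum_Diff[OF smg summable_on_finite[OF F(1)] F(2)] F(1) by simp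
    also have "(\<Sum>x\<in>F. norm (?g x)) \<le> (\<Sum>x\<in>F. w x * (1 / (4 * (S + 1))))"
    proof (rule sum_mono)
      fix x assume x: "x \<in> F"
      then have "norm (?g x) = w x * norm (x ^ p - 1)" using F(2) by (intro norm_g) auto
      then show "norm (?g x) \<le> w x * (1 / (4 * (S + 1)))"
        using mult_left_mono[OF less_imp_le[OF p(2)[OF x]] w(2)] by simp
    qed
    also have "\<dots> = sum w F * (1 / (4 * (S + 1)))" by (rule sum_distrib_right[symmetric])
    also have "\<dots> \<le> S * (1 / (4 * (S + 1)))" using sumF S0 by (intro mult_right_mono) auto
    also have "\<dots> \<le> 1 / 4" using S0 by (simp add: field_simps)
    also have "infsum (\<lambda>x. norm (?g x)) (circle - F) \<le> infsum (\<lambda>x. 2 * w x) (circle - F)"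
      using smgD sm2(2) by (rule infsum_mono) (use bound2 in auto)
    also have "\<dots> = 2 * infsum w (circle - F)" by (rule infsum_cmult_right')
    finally show ?thesis using tail by simp
  qed
  have z0: "z \<noteq> 0" using z by auto
  define c where "c = f p - f 0"
  \<comment> \<open>The increments \<open>f (n + p) - f n\<close> are all logarithms of
    \<open>z ^ p\<close> inside the unit disc, so they coincide with the one at
    \<open>n = 0\<close>.\<close>
  have step: "f (n + p) = f n + c" for n
  proof -
    have exp_diff_f: "exp (f (n + p) - f n) = z ^ p" for n
      using z0 by (simp add: exp_diff exp_f power_add)
    have "f (n + p) - f n = f (0 + p) - f 0"
      by (rule exp_inj_norm_less_1[OF _ close close]) (simp only: exp_diff_f)
    then show ?thesis by (simp add: c_def algebra_simps)
  qed
  \<comment> \<open>Along the multiples of \<open>p\<close> the sequence grows linearly with slope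
    \<open>c\<close>, which will contradict the bound \<open>B\<close> unless \<open>c\<close>
    vanishes.\<close>
  have lin: "f (n * p) = f 0 + of_nat n * c" for n
  proof (induction n)
    case (Suc n)
    have "f (Suc n * p) = f (n * p + p)" by (simp add: add.commute)
    also have "\<dots> = f 0 + of_nat (Suc n) * c"
      unfolding step Suc by (simp add: distrib_right)
    finally show ?case .
  qed simp
  define B where "B = enn2real (total_variation circle_borel a circle)"
  have B: "norm (f n) \<le> B" for n
    unfolding f_def B_def by (rule norm_atomic_transform_le[OF av])
  have bounded: "real n * norm c \<le> 2 * B" for n
  proof -
    have "real n * norm c = norm (f (n * p) - f 0)" by (simp add: lin norm_mult)
    also have "\<dots> \<le> 2 * B" using norm_triangle_ineq4[of "f (n * p)" "f 0"] B[of "n * p"] B[of 0] by simp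
    finally show ?thesis .
  qed
  have "c = 0"
  proof (rule ccontr)
    assume "c \<noteq> 0"
    then obtain n where "2 * B < real n * norm c" using reals_Archimedean3[of "norm c"] by auto
    then show False using bounded[of n] by linarith
  qed
  \<comment> \<open>Now \<open>f p = f 0\<close>, and exponentiating gives
    \<open>z ^ p = z ^ 0\<close>.\<close>
  then have "z ^ p = 1" using step[of 0] exp_f[of p] exp_f[of 0] by simp
  then show ?thesis using that p(1) by blast
qed

section \<open>The trivial exponential and the units\<close>

lemma total_variation_zero: "total_variation M (\<lambda>E. 0) E = 0"
proof -
  have "total_variation M (\<lambda>E. 0) E \<le> 0"
    unfolding total_variation_def by (rule SUP_least) simp
  then show ?thesis by simp
qed

text \<open>The unit is the exponential of the zero measure: the zeroth power of zero is
  \<open>dirac 1\<close> and the higher powers vanish, so the partial sums equal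
  \<open>dirac 1\<close> from \<open>n = 1\<close> on. It ensures that a point mass lies in its own
  coset.\<close>

lemma dirac_1_in_Exp: "dirac 1 \<in> Exp circle_measure_algebra"
proof -
  let ?A = circle_measure_algebra and ?z = "\<lambda>E::complex set. 0::complex"
  have pow: "?z [^]\<^bsub>?A\<^esub> k = (if k = 0 then dirac 1 else ?z)" for k :: nat
    by (cases k) (auto simp: pow_circle_measure_algebra_simps(1) pow_circle_measure_algebra_simps(2)
        convolution_def complex_measure_integral_zero)
  have d1: "complex_measure circle_borel (dirac 1)" by (simp add: complex_measure_dirac)
  have cm: "complex_measure circle_borel (\<lambda>E. (1 / fact k) * (?z [^]\<^bsub>?A\<^esub> k) E)" for k :: nat
    by (intro complex_measure_mult complex_measure_pow complex_measure_zero)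
  have "(\<Oplus>\<^bsub>?A\<^esub>k\<in>{..<n}. (1 / fact k) \<odot>\<^bsub>?A\<^esub> (?z [^]\<^bsub>?A\<^esub> (k::nat))) = dirac 1" if "n \<ge> 1" for n
  proof -
    have "(\<Sum>k<n. (1 / fact k) * (?z [^]\<^bsub>?A\<^esub> (k::nat)) E) = (\<Sum>k<n. if k = 0 then dirac 1 E else 0)" for E
      by (rule sum.cong) (auto simp: pow)
    then show ?thesis
      using that finsum_circle_measure_algebra[of "\<lambda>k E. (1 / fact k) * (?z [^]\<^bsub>?A\<^esub> k) E", OF cm]
      by (simp add: sum.delta)
  qed
  then have "\<forall>\<^sub>F n in sequentially. alg_norm ?A (dirac 1 \<ominus>\<^bsub>?A\<^esub>
      (\<Oplus>\<^bsub>?A\<^esub>k\<in>{..<n}. (1 / fact k) \<odot>\<^bsub>?A\<^esub> (?z [^]\<^bsub>?A\<^esub> (k::nat)))) = 0"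
    using minus_circle_measure_algebra[OF d1 d1]
    by (intro eventually_sequentiallyI[of 1]) (simp add: total_variation_zero)
  then have "has_exp ?A ?z (dirac 1)"
    unfolding has_exp_def by (rule tendsto_eventually)
  then show ?thesis
    using d1 complex_measure_zero by (auto simp: Exp_def carrier_circle_measure_algebra)
qed

lemma dirac_in_units:
  assumes "z \<in> circle"
  shows "dirac z \<in> carrier (units_of circle_measure_algebra)"
proof -
  have z: "inverse z \<in> circle" "z \<noteq> 0" using assms by (auto simp: norm_inverse)
  have "dirac (inverse z) \<in> carrier circle_measure_algebra" "dirac z \<in> carrier circle_measure_algebra"
    using assms z(1) by (simp_all only: carrier_circle_measure_algebra mem_Collect_eq complex_measure_dirac)
  moreover have "convolution (dirac (inverse z)) (dirac z) = dirac 1"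
    "convolution (dirac z) (dirac (inverse z)) = dirac 1"
    using assms z by (simp_all add: convolution_dirac_dirac)
  ultimately show ?thesis unfolding units_of_carrier Units_def by auto
qed

section \<open>Counting the cosets of the point masses\<close>

theorem theorem12:
  shows "uncountable (carrier (H1 circle_measure_algebra))"
proof
  let ?A = circle_measure_algebra
  assume cnt: "countable (carrier (H1 ?A))"
  define g where "g z = Exp ?A #>\<^bsub>units_of ?A\<^esub> dirac z" for z
  have "g z \<in> carrier (H1 ?A)" if "z \<in> circle" for z
    using dirac_in_units[OF that] by (auto simp: H1_def FactGroup_def RCOSETS_def g_def)
  then have "g ` circle \<subseteq> carrier (H1 ?A)" by blast
  then have cnt_g: "countable (g ` circle)" using cnt countable_subset by blast
  define R where "R = (\<Union>p\<in>{1..}. {u::complex. u ^ p = 1})"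
  have "countable R"
    unfolding R_def
  proof (rule countable_UN)
    show "countable {u::complex. u ^ p = 1}" if "p \<in> {1..}" for p :: nat
      using that by (intro countable_finite finite_roots_unity) simp
  qed simp
  \<comment> \<open>Point masses in one coset differ by a factor in \<open>Exp\<close>, which must
    be \<open>dirac (z / w)\<close>; hence \<open>z / w\<close> is a root of unity, and
    \<open>R\<close> is the countable set of these.\<close>
  have fibre: "{z \<in> circle. g z = g w} \<subseteq> (\<lambda>u. u * w) ` R" if w: "w \<in> circle" for w
  proof
    fix z assume "z \<in> {z \<in> circle. g z = g w}"
    then have z: "z \<in> circle" and eq: "g z = g w" by auto
    have "convolution (dirac 1) (dirac z) = dirac z"
      using z by (subst convolution_dirac_dirac) auto
    then have "dirac z \<in> g z"
      using dirac_1_in_Exp by (force simp: g_def r_coset_def units_of_mult)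
    then obtain e where e: "e \<in> Exp ?A" "convolution e (dirac w) = dirac z"
      unfolding eq by (auto simp: g_def r_coset_def units_of_mult)
    have "e = dirac (z / w)"
      using e z w by (intro convolution_dirac_cancel) (auto simp: Exp_def carrier_circle_measure_algebra)
    moreover have "z / w \<in> circle" using z w by (simp add: norm_divide)
    ultimately obtain p where "p \<ge> 1" "(z / w) ^ p = 1"
      using e(1) dirac_in_Exp_imp_torsion by metis
    then have "z / w \<in> R" by (auto simp: R_def)
    moreover have "w \<noteq> 0" using w by auto
    ultimately show "z \<in> (\<lambda>u. u * w) ` R" by (intro image_eqI[of _ _ "z / w"]) auto
  qed
  \<comment> \<open>With countably many cosets, the circle would be a countable union of countable
    fibres of \<open>g\<close>.\<close>
  have "circle = (\<Union>c\<in>g ` circle. {z \<in> circle. g z = c})" by auto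
  moreover have "countable (\<Union>c\<in>g ` circle. {z \<in> circle. g z = c})"
  proof (rule countable_UN[OF cnt_g])
    fix c assume "c \<in> g ` circle"
    then obtain w where "w \<in> circle" "c = g w" by blast
    then show "countable {z \<in> circle. g z = c}"
      using countable_subset[OF fibre countable_image[OF \<open>countable R\<close>]] by simp
  qed
  moreover have "uncountable circle"
    by (rule connected_uncountable[of _ 1 "-1"]) (auto intro: connected_sphere)
  ultimately show False by simp
qed

end
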